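(* Let $E=\Gamma(H\overrightarrow{\times}G,(u,0))$, where $(H,u)$ is an Abelian unital po-group with RDP and $G$ is an Abelian directed po-group with RDP. Then $E$ is a subdirect product of a family $(\Gamma(H_i\overrightarrow{\times}G_i,(u_i,0)))_i$ of antilattice effect algebras with RDP, where each $(H_i,u_i)$ is a unital Abelian po-group with RDP and each $G_i$ is a directed Abelian po-group with RDP.
   Context: An effect algebra is a partial algebra $(E;+,0,1)$ with a partial binary operation $+$ such that for all $a,b,c\in E$: (i) $a+b$ is defined iff $b+a$ is, and then $a+b=b+a$; (ii) $a+b$ and $(a+b)+c$ are defined iff $b+c$ and $a+(b+c)$ are, and then $(a+b)+c=a+(b+c)$; (iii) there is a unique $a^-\in E$ with $a+a^-=1$; (iv) if $a+1$ is defined then $a=0$. The order is $a\le b$ iff $a+c=b$ for some $c\in E$. A homomorphism $h:E\to F$ satisfies $h(1)=1$ and, whenever $a+b$ is defined, $h(a)+h(b)$ is defined and equals $h(a+b)$. A po-group is a group $(G;+,0)$ with a partial order such that $g\le h$ implies $k+g+f\le k+h+f$; $G^+=\{g:g\ge 0\}$. It is directed if any two elements have a common upper bound. A strong unit is $u\in G^+$ such that each $g\in G$ satisfies $g\le nu$ for some integer $n\ge0$; $(G,u)$ is then a unital po-group. For an Abelian po-group and $u\in G^+$, $\Gamma(G,u)=\{g:0\le g\le u\}$ is an effect algebra with $a+b$ defined iff $a\le u-b$, being then the group sum, and with top $u$. A poset (in particular an effect algebra) is an antilattice if only comparable pairs of elements have an infimum or a supremum. RDP for an Abelian po-group $G$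 (resp. an effect algebra $E$): whenever $a_1+a_2=b_1+b_2$ with all elements in $G^+$ (resp. $E$), there are $c_{11},c_{12},c_{21},c_{22}$ in $G^+$ (resp. $E$) with $a_1=c_{11}+c_{12}$, $a_2=c_{21}+c_{22}$, $b_1=c_{11}+c_{21}$, $b_2=c_{12}+c_{22}$. The lexicographic product $H\overrightarrow{\times}G$ is the group $H\times G$ with the order $(h_1,g_1)\le(h_2,g_2)$ iff $h_1<h_2$, or $h_1=h_2$ and $g_1\le g_2$. An effect algebra $E$ is a subdirect product of a system of effect algebras $(E_i:i\in I)$ if there is an injective homomorphism $f:E\to\prod_{i\in I}E_i$ (product with coordinatewise operations and order) such that $f(a)\le f(b)$ iff $a\le b$ ($a,b\in E$), and for every $j\in I$ the map $\pi_j\circ f$ is a surjective homomorphism from $E$ onto $E_j$, where $\pi_j$ is the $j$-th projection. *)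

theory Defs
  imports "HOL-Algebra.Group" "HOL-Library.FuncSet"
begin

text \<open>
  Groups carry the multiplicative notation of HOL-Algebra: \<open>\<otimes>\<close>, \<open>\<one>\<close>, \<open>inv\<close> and \<open>[^]\<close> are the
  group addition, zero, additive inverse and integer multiples of the (Abelian) po-groups.
\<close>

record 'a po_monoid = "'a monoid" +
  pole :: "'a \<Rightarrow> 'a \<Rightarrow> bool" (infixl \<open>\<preceq>\<index>\<close> 50)

definition po_order :: "('a, 'm) po_monoid_scheme \<Rightarrow> 'a gorder" where
  "po_order G = \<lparr>carrier = carrier G, eq = (=), le = pole G\<rparr>"

locale po_group = group G + ord: partial_order "po_order G"
  for G :: "('a, 'm) po_monoid_scheme" (structure) +
  assumes translate:
    "\<lbrakk>g \<in> carrier G; h \<in> carrier G; k \<in> carrier G; f \<in> carrier G; g \<preceq> h\<rbrakk>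
      \<Longrightarrow> k \<otimes> g \<otimes> f \<preceq> k \<otimes> h \<otimes> f"

locale abelian_po_group = po_group G + comm_group G
  for G :: "('a, 'm) po_monoid_scheme" (structure)

definition pos_cone :: "('a, 'm) po_monoid_scheme \<Rightarrow> 'a set" where
  "pos_cone G = {g \<in> carrier G. \<one>\<^bsub>G\<^esub> \<preceq>\<^bsub>G\<^esub> g}"

definition directed :: "('a, 'm) po_monoid_scheme \<Rightarrow> bool" where
  "directed G \<longleftrightarrow>
    (\<forall>g\<in>carrier G. \<forall>h\<in>carrier G. \<exists>k\<in>carrier G. g \<preceq>\<^bsub>G\<^esub> k \<and> h \<preceq>\<^bsub>G\<^esub> k)"

definition strong_unit :: "('a, 'm) po_monoid_scheme \<Rightarrow> 'a \<Rightarrow> bool" where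
  "strong_unit G u \<longleftrightarrow>
    u \<in> pos_cone G \<and> (\<forall>g\<in>carrier G. \<exists>n::nat. g \<preceq>\<^bsub>G\<^esub> u [^]\<^bsub>G\<^esub> n)"

definition group_RDP :: "('a, 'm) po_monoid_scheme \<Rightarrow> bool" where
  "group_RDP G \<longleftrightarrow>
    (\<forall>a1\<in>pos_cone G. \<forall>a2\<in>pos_cone G. \<forall>b1\<in>pos_cone G. \<forall>b2\<in>pos_cone G.
      a1 \<otimes>\<^bsub>G\<^esub> a2 = b1 \<otimes>\<^bsub>G\<^esub> b2 \<longrightarrow>
      (\<exists>c11\<in>pos_cone G. \<exists>c12\<in>pos_cone G. \<exists>c21\<in>pos_cone G. \<exists>c22\<in>pos_cone G.
        a1 = c11 \<otimes>\<^bsub>G\<^esub> c12 \<and> a2 = c21 \<otimes>\<^bsub>G\<^esub> c22 \<and>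
        b1 = c11 \<otimes>\<^bsub>G\<^esub> c21 \<and> b2 = c12 \<otimes>\<^bsub>G\<^esub> c22))"

definition lexico_prod ::
    "('a, 'm) po_monoid_scheme \<Rightarrow> ('b, 'n) po_monoid_scheme \<Rightarrow> ('a \<times> 'b) po_monoid" where
  "lexico_prod H G =
    \<lparr>carrier = carrier (H \<times>\<times> G), mult = mult (H \<times>\<times> G), one = one (H \<times>\<times> G),
     pole = (\<lambda>(h1, g1) (h2, g2).
       (h1 \<preceq>\<^bsub>H\<^esub> h2 \<and> h1 \<noteq> h2) \<or> (h1 = h2 \<and> g1 \<preceq>\<^bsub>G\<^esub> g2))\<rparr>"

text \<open>
  The partial sum is option-valued, \<open>None\<close> meaning undefined, so an equation between option
  terms says that one side is defined iff the other is, and that they then agree.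
\<close>

record 'a peff = "'a partial_object" +
  psum :: "'a \<Rightarrow> 'a \<Rightarrow> 'a option"
  ezero :: 'a
  eone :: 'a

locale effect_algebra =
  fixes E :: "('a, 'm) peff_scheme" (structure)
  assumes zero_closed: "ezero E \<in> carrier E"
    and one_closed: "eone E \<in> carrier E"
    and sum_closed: "\<lbrakk>a \<in> carrier E; b \<in> carrier E; psum E a b = Some c\<rbrakk> \<Longrightarrow> c \<in> carrier E"
    and sum_comm: "\<lbrakk>a \<in> carrier E; b \<in> carrier E\<rbrakk> \<Longrightarrow> psum E a b = psum E b a"
    and sum_assoc: "\<lbrakk>a \<in> carrier E; b \<in> carrier E; c \<in> carrier E\<rbrakk>
      \<Longrightarrow> Option.bind (psum E a b) (\<lambda>x. psum E x c) = Option.bind (psum E b c) (psum E a)"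
    and orthosupplement: "a \<in> carrier E \<Longrightarrow> \<exists>!x. x \<in> carrier E \<and> psum E a x = Some (eone E)"
    and sum_one: "\<lbrakk>a \<in> carrier E; psum E a (eone E) \<noteq> None\<rbrakk> \<Longrightarrow> a = ezero E"

definition eff_le :: "('a, 'm) peff_scheme \<Rightarrow> 'a \<Rightarrow> 'a \<Rightarrow> bool" where
  "eff_le E a b \<longleftrightarrow> (\<exists>c\<in>carrier E. psum E a c = Some b)"

definition eff_order :: "('a, 'm) peff_scheme \<Rightarrow> 'a gorder" where
  "eff_order E = \<lparr>carrier = carrier E, eq = (=), le = eff_le E\<rparr>"

definition eff_hom ::
    "('a, 'm) peff_scheme \<Rightarrow> ('b, 'n) peff_scheme \<Rightarrow> ('a \<Rightarrow> 'b) \<Rightarrow> bool" where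
  "eff_hom E F h \<longleftrightarrow>
    h \<in> carrier E \<rightarrow> carrier F \<and> h (eone E) = eone F \<and>
    (\<forall>a\<in>carrier E. \<forall>b\<in>carrier E. \<forall>c.
      psum E a b = Some c \<longrightarrow> psum F (h a) (h b) = Some (h c))"

definition eff_RDP :: "('a, 'm) peff_scheme \<Rightarrow> bool" where
  "eff_RDP E \<longleftrightarrow>
    (\<forall>a1\<in>carrier E. \<forall>a2\<in>carrier E. \<forall>b1\<in>carrier E. \<forall>b2\<in>carrier E. \<forall>s.
      psum E a1 a2 = Some s \<and> psum E b1 b2 = Some s \<longrightarrow>
      (\<exists>c11\<in>carrier E. \<exists>c12\<in>carrier E. \<exists>c21\<in>carrier E. \<exists>c22\<in>carrier E.
        psum E c11 c12 = Some a1 \<and> psum E c21 c22 = Some a2 \<and>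
        psum E c11 c21 = Some b1 \<and> psum E c12 c22 = Some b2))"

definition antilattice :: "('a, 'm) gorder_scheme \<Rightarrow> bool" where
  "antilattice L \<longleftrightarrow>
    (\<forall>x\<in>carrier L. \<forall>y\<in>carrier L.
      (\<exists>i. greatest L i (Lower L {x, y})) \<or> (\<exists>s. least L s (Upper L {x, y})) \<longrightarrow>
      x \<sqsubseteq>\<^bsub>L\<^esub> y \<or> y \<sqsubseteq>\<^bsub>L\<^esub> x)"

definition Gamma :: "('a, 'm) po_monoid_scheme \<Rightarrow> 'a \<Rightarrow> 'a peff" where
  "Gamma G u =
    \<lparr>carrier = {g \<in> carrier G. \<one>\<^bsub>G\<^esub> \<preceq>\<^bsub>G\<^esub> g \<and> g \<preceq>\<^bsub>G\<^esub> u},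
     psum = (\<lambda>a b. if a \<preceq>\<^bsub>G\<^esub> u \<otimes>\<^bsub>G\<^esub> inv\<^bsub>G\<^esub> b then Some (a \<otimes>\<^bsub>G\<^esub> b) else None),
     ezero = \<one>\<^bsub>G\<^esub>, eone = u\<rparr>"

definition eff_prod :: "'i set \<Rightarrow> ('i \<Rightarrow> ('a, 'm) peff_scheme) \<Rightarrow> ('i \<Rightarrow> 'a) peff" where
  "eff_prod I F =
    \<lparr>carrier = (\<Pi>\<^sub>E i\<in>I. carrier (F i)),
     psum = (\<lambda>x y. if \<forall>i\<in>I. psum (F i) (x i) (y i) \<noteq> None
                   then Some (\<lambda>i\<in>I. the (psum (F i) (x i) (y i))) else None),
     ezero = (\<lambda>i\<in>I. ezero (F i)), eone = (\<lambda>i\<in>I. eone (F i))\<rparr>"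

lemma eff_le_prod_iff:
  assumes "x \<in> carrier (eff_prod I F)" "y \<in> carrier (eff_prod I F)"
  shows "eff_le (eff_prod I F) x y \<longleftrightarrow> (\<forall>i\<in>I. eff_le (F i) (x i) (y i))"
proof
  assume "eff_le (eff_prod I F) x y"
  then obtain z where z: "z \<in> (\<Pi>\<^sub>E i\<in>I. carrier (F i))"
    and def: "\<forall>i\<in>I. psum (F i) (x i) (z i) \<noteq> None"
    and y: "y = (\<lambda>i\<in>I. the (psum (F i) (x i) (z i)))"
    by (auto simp: eff_le_def eff_prod_def split: if_splits)
  show "\<forall>i\<in>I. eff_le (F i) (x i) (y i)"
    unfolding eff_le_def
  proof
    fix i assume "i \<in> I"
    with z def y show "\<exists>c\<in>carrier (F i). psum (F i) (x i) c = Some (y i)"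
      by (intro bexI[of _ "z i"]) auto
  qed
next
  assume "\<forall>i\<in>I. eff_le (F i) (x i) (y i)"
  then obtain z where z: "\<forall>i\<in>I. z i \<in> carrier (F i) \<and> psum (F i) (x i) (z i) = Some (y i)"
    unfolding eff_le_def by metis
  have "y = restrict y I"
    using assms(2) by (simp add: eff_prod_def PiE_def extensional_restrict)
  also have "\<dots> = (\<lambda>i\<in>I. the (psum (F i) (x i) (restrict z I i)))"
    using z by (intro restrict_ext) simp
  finally show "eff_le (eff_prod I F) x y"
    using z unfolding eff_le_def eff_prod_def
    by (intro bexI[of _ "restrict z I"]) auto
qed

definition subdirect_product ::
    "('a, 'm) peff_scheme \<Rightarrow> 'i set \<Rightarrow> ('i \<Rightarrow> ('b, 'n) peff_scheme) \<Rightarrow> bool" where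
  "subdirect_product E I F \<longleftrightarrow>
    (\<exists>f. eff_hom E (eff_prod I F) f \<and> inj_on f (carrier E) \<and>
      (\<forall>a\<in>carrier E. \<forall>b\<in>carrier E. eff_le (eff_prod I F) (f a) (f b) \<longleftrightarrow> eff_le E a b) \<and>
      (\<forall>j\<in>I. eff_hom E (F j) (\<lambda>a. f a j) \<and> (\<lambda>a. f a j) ` carrier E = carrier (F j)))"

end

theory Submission
  imports Defs "HOL-Algebra.Coset"
begin

text \<open>
  In additive notation: RDP is equivalent to the interpolation property, which passes to quotients by o-ideals (convex
  directed subgroups). If \<open>x\<close> is not positive in \<open>G\<close>, take by Zorn an o-ideal \<open>P\<close> maximal subject to
  \<open>x + P\<close> not being positive. If \<open>a, b > 0\<close> in \<open>G/P\<close> had infimum \<open>0\<close>, then by maximality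
  \<open>-x \<le> na\<close> and \<open>-x \<le> mb\<close> modulo \<open>P\<close> for some \<open>n, m\<close>, whence \<open>-x \<le> 0\<close>, a contradiction; so with
  interpolation \<open>G/P\<close> is an antilattice. Applied to \<open>H\<close> this gives the factors
  \<open>H/Q \<times> G/G\<close>, applied to \<open>G\<close> the factors \<open>H/0 \<times> G/P\<close>. Two elements of the lexicographic product
  that are not in the relation \<open>\<le>\<close> are separated by a factor of the first kind if this is visible in
  the first coordinate, and of the second kind otherwise.
\<close>

section \<open>Interpolation and orthogonality\<close>

text \<open>The obstacle is that H \<times> G \<rightarrow> H/Q \<times> G/P need not respect the
  lexicographic order. If a < c in H and Q identifies a with c, then the second coordinates, which
  were arbitrary, have to be comparable modulo P. This is harmless if G is collapsed completely, and
  it cannot happen if Q = 0; hence the two kinds of factor. Each kind is an antilattice for its own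
  reason. With G/G trivial, the product is a copy of H/Q. With H kept whole, H itself may have many
  infima, but two elements with strictly positive first coordinates have a whole copy of G/P among
  their common lower bounds at level 0; a nontrivial group has no greatest element, so zero is not
  their infimum. RDP is traded for interpolation because the latter speaks of inequalities only: an
  inequality modulo P becomes an inequality in G after adding an element of P to one side, whereas
  the equation in RDP would survive only modulo P. Interpolation also moves lower bounds found in
  the group into an interval, which links infima in the effect algebra with infima in the
  group.\<close>

definition interpolation :: "('a, 'm) po_monoid_scheme \<Rightarrow> bool" where
  "interpolation G \<longleftrightarrow>
    (\<forall>a1\<in>carrier G. \<forall>a2\<in>carrier G. \<forall>b1\<in>carrier G. \<forall>b2\<in>carrier G.
      a1 \<preceq>\<^bsub>G\<^esub> b1 \<and> a1 \<preceq>\<^bsub>G\<^esub> b2 \<and> a2 \<preceq>\<^bsub>G\<^esub> b1 \<and> a2 \<preceq>\<^bsub>G\<^esub> b2 \<longrightarrow>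
      (\<exists>c\<in>carrier G. a1 \<preceq>\<^bsub>G\<^esub> c \<and> a2 \<preceq>\<^bsub>G\<^esub> c \<and> c \<preceq>\<^bsub>G\<^esub> b1 \<and> c \<preceq>\<^bsub>G\<^esub> b2))"

text \<open>Zero is the infimum of a and b in the whole group. Letting \<open>x\<close> leave the
  positive cone keeps differences such as x - b admissible in inductions.\<close>

definition orthogonal :: "('a, 'm) po_monoid_scheme \<Rightarrow> 'a \<Rightarrow> 'a \<Rightarrow> bool" where
  "orthogonal G a b \<longleftrightarrow> a \<in> pos_cone G \<and> b \<in> pos_cone G \<and>
    (\<forall>x\<in>carrier G. x \<preceq>\<^bsub>G\<^esub> a \<and> x \<preceq>\<^bsub>G\<^esub> b \<longrightarrow> x \<preceq>\<^bsub>G\<^esub> \<one>\<^bsub>G\<^esub>)"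

text \<open>Translation carries any infimum in the group to zero, and s - x, s - y have infimum zero
  if s is the supremum of x and y. So this is the antilattice property of the po-group reduced to a
  single case.\<close>

definition po_prime :: "('a, 'm) po_monoid_scheme \<Rightarrow> bool" where
  "po_prime G \<longleftrightarrow> (\<forall>a b. orthogonal G a b \<longrightarrow> a = \<one>\<^bsub>G\<^esub> \<or> b = \<one>\<^bsub>G\<^esub>)"

definition o_ideal :: "('a, 'm) po_monoid_scheme \<Rightarrow> 'a set \<Rightarrow> bool" where
  "o_ideal G P \<longleftrightarrow> subgroup P G \<and>
    (\<forall>a\<in>P. \<forall>b\<in>P. \<forall>x\<in>carrier G. a \<preceq>\<^bsub>G\<^esub> x \<longrightarrow> x \<preceq>\<^bsub>G\<^esub> b \<longrightarrow> x \<in> P) \<and>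
    (\<forall>a\<in>P. \<forall>b\<in>P. \<exists>c\<in>P. a \<preceq>\<^bsub>G\<^esub> c \<and> b \<preceq>\<^bsub>G\<^esub> c)"

text \<open>Quantifying over representatives on both sides makes the order well defined at once.
  Convexity of \<open>P\<close> is needed for antisymmetry.\<close>

definition po_quot :: "('a, 'm) po_monoid_scheme \<Rightarrow> 'a set \<Rightarrow> 'a set po_monoid" where
  "po_quot G P =
    \<lparr>carrier = carrier (G Mod P), mult = mult (G Mod P), one = one (G Mod P),
     pole = (\<lambda>A B. \<exists>a\<in>A. \<exists>b\<in>B. a \<preceq>\<^bsub>G\<^esub> b)\<rparr>"

section \<open>Order arithmetic in Abelian po-groups\<close>

lemma abelian_po_groupI:
  fixes G (structure)
  assumes "comm_group G"
    and refl: "\<And>a. a \<in> carrier G \<Longrightarrow> a \<preceq> a"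
    and antisym: "\<And>a b. \<lbrakk>a \<in> carrier G; b \<in> carrier G; a \<preceq> b; b \<preceq> a\<rbrakk> \<Longrightarrow> a = b"
    and trans: "\<And>a b c. \<lbrakk>a \<in> carrier G; b \<in> carrier G; c \<in> carrier G; a \<preceq> b; b \<preceq> c\<rbrakk> \<Longrightarrow> a \<preceq> c"
    and mono: "\<And>a b c. \<lbrakk>a \<in> carrier G; b \<in> carrier G; c \<in> carrier G; a \<preceq> b\<rbrakk> \<Longrightarrow> c \<otimes> a \<preceq> c \<otimes> b"
  shows "abelian_po_group G"
proof -
  interpret comm_group G by fact
  have "partial_order (po_order G)"
    by standard (auto simp: po_order_def intro: refl antisym trans)
  moreover have "k \<otimes> g \<otimes> f \<preceq> k \<otimes> h \<otimes> f"
    if "g \<in> carrier G" "h \<in> carrier G" "k \<in> carrier G" "f \<in> carrier G" "g \<preceq> h" for g h k f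
    using mono[of g h "k \<otimes> f"] that by (simp add: m_ac)
  ultimately show ?thesis
    by (intro abelian_po_group.intro po_group.intro po_group_axioms.intro)
      (auto intro: is_group assms(1))
qed

context abelian_po_group
begin

lemma pole_refl [simp]: "a \<in> carrier G \<Longrightarrow> a \<preceq> a"
  using ord.le_refl by (simp add: po_order_def)

lemma pole_antisym: "\<lbrakk>a \<preceq> b; b \<preceq> a; a \<in> carrier G; b \<in> carrier G\<rbrakk> \<Longrightarrow> a = b"
  using ord.le_antisym by (simp add: po_order_def)

lemma pole_trans [trans]:
  "\<lbrakk>a \<preceq> b; b \<preceq> c; a \<in> carrier G; b \<in> carrier G; c \<in> carrier G\<rbrakk> \<Longrightarrow> a \<preceq> c"
  using ord.le_trans by (simp add: po_order_def)

lemma mult_left_mono: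
  "\<lbrakk>a \<preceq> b; a \<in> carrier G; b \<in> carrier G; c \<in> carrier G\<rbrakk> \<Longrightarrow> c \<otimes> a \<preceq> c \<otimes> b"
  using translate[of a b c \<one>] by simp

lemma mult_left_le_iff [simp]:
  assumes "a \<in> carrier G" "b \<in> carrier G" "c \<in> carrier G"
  shows "c \<otimes> a \<preceq> c \<otimes> b \<longleftrightarrow> a \<preceq> b"
proof
  assume "c \<otimes> a \<preceq> c \<otimes> b"
  then have "inv c \<otimes> (c \<otimes> a) \<preceq> inv c \<otimes> (c \<otimes> b)"
    using assms mult_left_mono[of "c \<otimes> a" "c \<otimes> b" "inv c"] by simp
  then show "a \<preceq> b"
    using assms by (simp flip: m_assoc)
qed (rule mult_left_mono[OF _ assms])

lemma mult_right_le_iff [simp]: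
  assumes "a \<in> carrier G" "b \<in> carrier G" "c \<in> carrier G"
  shows "a \<otimes> c \<preceq> b \<otimes> c \<longleftrightarrow> a \<preceq> b"
  using mult_left_le_iff[OF assms] assms by (simp add: m_comm)

lemma mult_mono:
  assumes "a \<preceq> b" "c \<preceq> d" "a \<in> carrier G" "b \<in> carrier G" "c \<in> carrier G" "d \<in> carrier G"
  shows "a \<otimes> c \<preceq> b \<otimes> d"
  using assms pole_trans[of "a \<otimes> c" "b \<otimes> c" "b \<otimes> d"] by simp

lemma le_mult_right [simp]:
  assumes "a \<in> carrier G" "b \<in> carrier G"
  shows "a \<preceq> a \<otimes> b \<longleftrightarrow> \<one> \<preceq> b"
  using mult_left_le_iff[of \<one> b a] assms by simp

lemma le_mult_left [simp]:
  assumes "a \<in> carrier G" "b \<in> carrier G"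
  shows "a \<preceq> b \<otimes> a \<longleftrightarrow> \<one> \<preceq> b"
  using mult_right_le_iff[of \<one> b a] assms by simp

lemma le_mult_inv_iff:
  assumes "a \<in> carrier G" "b \<in> carrier G" "c \<in> carrier G"
  shows "a \<preceq> c \<otimes> inv b \<longleftrightarrow> a \<otimes> b \<preceq> c"
  using mult_right_le_iff[of a "c \<otimes> inv b" b] assms by (simp add: m_assoc)

lemma inv_le_iff:
  assumes "a \<in> carrier G" "b \<in> carrier G"
  shows "inv a \<preceq> b \<longleftrightarrow> \<one> \<preceq> a \<otimes> b"
  using mult_left_le_iff[of "inv a" b a] assms by simp

lemma mult_le_self_iff [simp]:
  "\<lbrakk>a \<in> carrier G; b \<in> carrier G\<rbrakk> \<Longrightarrow> a \<otimes> b \<preceq> a \<longleftrightarrow> b \<preceq> \<one>"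
  using mult_left_le_iff[of b \<one> a] by simp

lemma mult_le_self_iff' [simp]:
  "\<lbrakk>a \<in> carrier G; b \<in> carrier G\<rbrakk> \<Longrightarrow> b \<otimes> a \<preceq> a \<longleftrightarrow> b \<preceq> \<one>"
  using mult_right_le_iff[of b \<one> a] by simp

lemma inv_le_one_iff [simp]: "a \<in> carrier G \<Longrightarrow> inv a \<preceq> \<one> \<longleftrightarrow> \<one> \<preceq> a"
  by (simp add: inv_le_iff)

lemma one_le_inv_iff [simp]: "a \<in> carrier G \<Longrightarrow> \<one> \<preceq> inv a \<longleftrightarrow> a \<preceq> \<one>"
  using le_mult_inv_iff[of \<one> a \<one>] by simp

lemma mult_inv_le_iff:
  assumes "a \<in> carrier G" "b \<in> carrier G" "c \<in> carrier G"
  shows "a \<otimes> inv b \<preceq> c \<longleftrightarrow> a \<preceq> c \<otimes> b"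
  using le_mult_inv_iff[of a "inv b" c] assms by simp

lemma leE:
  assumes "a \<preceq> b" "a \<in> carrier G" "b \<in> carrier G"
  obtains p where "p \<in> carrier G" "\<one> \<preceq> p" "b = a \<otimes> p"
proof
  show "b = a \<otimes> (inv a \<otimes> b)" "inv a \<otimes> b \<in> carrier G"
    using assms by (simp_all flip: m_assoc)
  then show "\<one> \<preceq> inv a \<otimes> b"
    using assms le_mult_right[of a "inv a \<otimes> b"] by simp
qed

text \<open>Both pairings of the differences have the same sum: (b1 - a1) + (b2 - a2) = (b2 - a1) +
  (b1 - a2). In the refinement, c11 is the common part of b1 - a1 and b2 - a1, so a1 + c11 stays
  below b1 and b2. Cancelling c12 in the two expressions for b1 gives a1 + c11 = a2 + c22, hence it
  also lies above a2.\<close>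

lemma RDP_imp_interpolation:
  assumes "group_RDP G"
  shows "interpolation G"
  unfolding interpolation_def
proof (intro ballI impI, elim conjE)
  fix a1 a2 b1 b2
  assume cl: "a1 \<in> carrier G" "a2 \<in> carrier G" "b1 \<in> carrier G" "b2 \<in> carrier G"
    and le: "a1 \<preceq> b1" "a1 \<preceq> b2" "a2 \<preceq> b1" "a2 \<preceq> b2"
  obtain p where p: "p \<in> carrier G" "\<one> \<preceq> p" "b1 = a1 \<otimes> p" using leE le(1) cl by blast
  obtain q where q: "q \<in> carrier G" "\<one> \<preceq> q" "b2 = a2 \<otimes> q" using leE le(4) cl by blast
  obtain r where r: "r \<in> carrier G" "\<one> \<preceq> r" "b2 = a1 \<otimes> r" using leE le(2) cl by blast
  obtain s where s: "s \<in> carrier G" "\<one> \<preceq> s" "b1 = a2 \<otimes> s" using leE le(3) cl by blast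
  have "(a1 \<otimes> a2) \<otimes> (p \<otimes> q) = b1 \<otimes> b2"
    using cl p q by (simp add: m_ac)
  also have "\<dots> = (a1 \<otimes> a2) \<otimes> (r \<otimes> s)"
    unfolding r(3) s(3) using cl r(1) s(1) by (simp add: m_ac)
  finally have "p \<otimes> q = r \<otimes> s"
    using cl p(1) q(1) r(1) s(1) by simp
  then obtain c11 c12 c21 c22
    where c: "c11 \<in> pos_cone G" "c12 \<in> pos_cone G" "c21 \<in> pos_cone G" "c22 \<in> pos_cone G"
      and eq: "p = c11 \<otimes> c12" "q = c21 \<otimes> c22" "r = c11 \<otimes> c21" "s = c12 \<otimes> c22"
    using assms[unfolded group_RDP_def, rule_format, of p q r s] p q r s
    by (auto simp: pos_cone_def)
  note c' = c[unfolded pos_cone_def, simplified]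
  have "c12 \<otimes> (a1 \<otimes> c11) = c12 \<otimes> (a2 \<otimes> c22)"
    using p(3) s(3) eq c' cl by (simp add: m_ac)
  then have x: "a1 \<otimes> c11 = a2 \<otimes> c22"
    using c' cl by simp
  have "a1 \<otimes> c11 \<preceq> b1" "a1 \<otimes> c11 \<preceq> b2"
    unfolding p(3) r(3) eq using c' cl by simp_all
  moreover have "a1 \<preceq> a1 \<otimes> c11" "a2 \<preceq> a1 \<otimes> c11"
    using c' cl by (simp, simp add: x)
  ultimately show "\<exists>c\<in>carrier G. a1 \<preceq> c \<and> a2 \<preceq> c \<and> c \<preceq> b1 \<and> c \<preceq> b2"
    using cl c' by (intro bexI[of _ "a1 \<otimes> c11"]) auto
qed

text \<open>A refinement is determined by the single element z = b2 + c11 = a1 + c22. Its entries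
  are z - b2, a1 + b2 - z, b1 + b2 - z and z - a1, and they are all nonnegative exactly if z
  interpolates between a1, b2 and a1 + b2, b1 + b2.\<close>

lemma interpolation_imp_RDP:
  assumes "interpolation G"
  shows "group_RDP G"
  unfolding group_RDP_def
proof (intro ballI impI)
  fix a1 a2 b1 b2
  assume "a1 \<in> pos_cone G" "a2 \<in> pos_cone G" "b1 \<in> pos_cone G" "b2 \<in> pos_cone G"
    and eq: "a1 \<otimes> a2 = b1 \<otimes> b2"
  then have cl: "a1 \<in> carrier G" "a2 \<in> carrier G" "b1 \<in> carrier G" "b2 \<in> carrier G"
    and pos: "\<one> \<preceq> a1" "\<one> \<preceq> a2" "\<one> \<preceq> b1" "\<one> \<preceq> b2"
    by (auto simp: pos_cone_def)
  have "b2 \<preceq> a1 \<otimes> b2" "b2 \<preceq> b1 \<otimes> b2" "a1 \<preceq> a1 \<otimes> b2" "a1 \<preceq> b1 \<otimes> b2"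
    using cl pos by (simp_all, simp flip: eq)
  then obtain z where z: "z \<in> carrier G" "b2 \<preceq> z" "a1 \<preceq> z" "z \<preceq> a1 \<otimes> b2" "z \<preceq> b1 \<otimes> b2"
    using assms cl unfolding interpolation_def by (metis m_closed)
  obtain c11 where c11: "c11 \<in> carrier G" "\<one> \<preceq> c11" "z = b2 \<otimes> c11" using leE z cl by blast
  obtain c22 where c22: "c22 \<in> carrier G" "\<one> \<preceq> c22" "z = a1 \<otimes> c22" using leE z cl by blast
  obtain c12 where c12: "c12 \<in> carrier G" "\<one> \<preceq> c12" "a1 \<otimes> b2 = z \<otimes> c12"
    using leE z cl by (metis m_closed)
  obtain c21 where c21: "c21 \<in> carrier G" "\<one> \<preceq> c21" "b1 \<otimes> b2 = z \<otimes> c21"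
    using leE z cl by (metis m_closed)
  have "b2 \<otimes> a1 = b2 \<otimes> (c11 \<otimes> c12)"
    using c12(3) c11 c12(1) cl by (simp add: m_ac)
  moreover have "b2 \<otimes> b1 = b2 \<otimes> (c11 \<otimes> c21)"
    using c21(3) c11 c21(1) cl by (simp add: m_ac)
  moreover have "a1 \<otimes> b2 = a1 \<otimes> (c12 \<otimes> c22)"
    using c12(3) c22 c12(1) cl by (simp add: m_ac)
  moreover have "a1 \<otimes> a2 = a1 \<otimes> (c21 \<otimes> c22)"
    using c21(3) c22 c21(1) cl by (simp add: m_ac eq)
  ultimately have "a1 = c11 \<otimes> c12 \<and> a2 = c21 \<otimes> c22 \<and> b1 = c11 \<otimes> c21 \<and> b2 = c12 \<otimes> c22"
    using c11(1) c12(1) c21(1) c22(1) cl by simp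
  then show "\<exists>c11\<in>pos_cone G. \<exists>c12\<in>pos_cone G. \<exists>c21\<in>pos_cone G. \<exists>c22\<in>pos_cone G.
        a1 = c11 \<otimes> c12 \<and> a2 = c21 \<otimes> c22 \<and> b1 = c11 \<otimes> c21 \<and> b2 = c12 \<otimes> c22"
    using c11 c12 c21 c22 unfolding pos_cone_def by blast
qed

lemma nat_pow_pos: "\<lbrakk>a \<in> carrier G; \<one> \<preceq> a\<rbrakk> \<Longrightarrow> \<one> \<preceq> a [^] (n::nat)"
proof (induction n)
  case (Suc n)
  then show ?case using mult_mono[of \<one> "a [^] n" \<one> a] by simp
qed simp

text \<open>If x <= a and x <= (m+1)b, then x - b lies below mb, and below a because b is
  nonnegative. By induction x - b <= 0, that is x <= b, and orthogonality applies to x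
  itself.\<close>

lemma orthogonal_pow_right:
  assumes "orthogonal G a b" "x \<in> carrier G" "x \<preceq> a" "x \<preceq> b [^] (m::nat)"
  shows "x \<preceq> \<one>"
  using assms(2-)
proof (induction m arbitrary: x)
  case (Suc m)
  have ab: "a \<in> carrier G" "b \<in> carrier G" "\<one> \<preceq> b"
    using assms(1) by (auto simp: orthogonal_def pos_cone_def)
  have "x \<otimes> inv b \<preceq> b [^] m"
    using Suc.prems ab le_mult_inv_iff[of x "inv b" "b [^] m"] by simp
  moreover have "x \<otimes> inv b \<preceq> a"
    using Suc.prems ab mult_mono[of x a \<one> b] le_mult_inv_iff[of x "inv b" a] by simp
  ultimately have "x \<otimes> inv b \<preceq> \<one>"
    using Suc ab by simp
  then have "x \<preceq> b"
    using Suc.prems ab le_mult_inv_iff[of x "inv b" \<one>] by simp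
  then show ?case
    using Suc.prems assms(1) by (simp add: orthogonal_def)
qed simp

text \<open>The one-sided version makes a and mb orthogonal; after swapping the roles it applies
  once more, now to multiples of a.\<close>

lemma orthogonal_pow:
  assumes "orthogonal G a b" "x \<in> carrier G" "x \<preceq> a [^] (n::nat)" "x \<preceq> b [^] (m::nat)"
  shows "x \<preceq> \<one>"
proof -
  have "orthogonal G (b [^] m) a"
    using assms(1) orthogonal_pow_right[OF assms(1)] nat_pow_pos[of b m]
    by (auto simp: orthogonal_def pos_cone_def)
  from orthogonal_pow_right[OF this assms(2,4,3)] show ?thesis .
qed

end

section \<open>Quotients by o-ideals\<close>

lemma o_ideal_subgroup: "o_ideal G P \<Longrightarrow> subgroup P G"
  by (simp add: o_ideal_def)

lemma o_ideal_convex: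
  fixes G (structure)
  shows "\<lbrakk>o_ideal G P; a \<preceq> x; x \<preceq> b; a \<in> P; b \<in> P; x \<in> carrier G\<rbrakk> \<Longrightarrow> x \<in> P"
  unfolding o_ideal_def by blast

lemma o_ideal_upper2:
  fixes G (structure)
  assumes "o_ideal G P" "a \<in> P" "b \<in> P"
  obtains c where "c \<in> P" "a \<preceq> c" "b \<preceq> c"
  using assms unfolding o_ideal_def by blast

context abelian_po_group
begin

lemma o_ideal_carrierD: "\<lbrakk>o_ideal G P; a \<in> P\<rbrakk> \<Longrightarrow> a \<in> carrier G"
  using o_ideal_subgroup subgroup.mem_carrier by metis

lemma o_ideal_one: "o_ideal G P \<Longrightarrow> \<one> \<in> P"
  using o_ideal_subgroup subgroup.one_closed by metis

lemma o_ideal_mult: "\<lbrakk>o_ideal G P; a \<in> P; b \<in> P\<rbrakk> \<Longrightarrow> a \<otimes> b \<in> P"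
  using o_ideal_subgroup subgroup.m_closed by metis

lemma o_ideal_inv: "\<lbrakk>o_ideal G P; a \<in> P\<rbrakk> \<Longrightarrow> inv a \<in> P"
  using o_ideal_subgroup subgroup.m_inv_closed by metis

lemma o_ideal_upper_pos:
  assumes "o_ideal G P" "a \<in> P"
  obtains c where "c \<in> P" "a \<preceq> c" "\<one> \<preceq> c"
  using o_ideal_upper2[OF assms o_ideal_one[OF assms(1)]] by blast

lemma o_ideal_normal: "o_ideal G P \<Longrightarrow> P \<lhd> G"
  by (simp add: o_ideal_def subgroup_imp_normal)

lemma o_ideal_singleton: "o_ideal G {\<one>}"
  using pole_antisym by (auto simp: o_ideal_def triv_subgroup)

lemma o_ideal_carrier: "directed G \<Longrightarrow> o_ideal G (carrier G)"
  by (auto simp: o_ideal_def directed_def subgroup_self)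

lemma rcos_mem_iff: "\<lbrakk>o_ideal G P; a \<in> carrier G\<rbrakk> \<Longrightarrow> x \<in> P #> a \<longleftrightarrow> (\<exists>p\<in>P. x = a \<otimes> p)"
  using o_ideal_carrierD by (auto simp: r_coset_def m_comm)

lemma rcos_eq_iff:
  assumes "o_ideal G P" "a \<in> carrier G" "b \<in> carrier G"
  shows "P #> a = P #> b \<longleftrightarrow> (\<exists>p\<in>P. a = b \<otimes> p)"
  using assms rcos_mem_iff rcos_self repr_independence o_ideal_subgroup by metis

lemma rcos_eq_ideal_iff:
  assumes "o_ideal G P" "a \<in> carrier G"
  shows "P #> a = P \<longleftrightarrow> a \<in> P"
  using coset_join1 coset_join2 assms o_ideal_subgroup by metis

lemma rcos_singleton: "a \<in> carrier G \<Longrightarrow> {\<one>} #> a = {a}"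
  by (simp add: r_coset_def)

lemma carrier_po_quot: "carrier (po_quot G P) = (\<lambda>a. P #> a) ` carrier G"
  by (auto simp: po_quot_def carrier_FactGroup)

lemma one_po_quot [simp]: "\<one>\<^bsub>po_quot G P\<^esub> = P"
  by (simp add: po_quot_def)

lemma mult_po_quot:
  "\<lbrakk>o_ideal G P; a \<in> carrier G; b \<in> carrier G\<rbrakk>
    \<Longrightarrow> (P #> a) \<otimes>\<^bsub>po_quot G P\<^esub> (P #> b) = P #> (a \<otimes> b)"
  using normal.rcos_sum[OF o_ideal_normal] by (simp add: po_quot_def)

lemma pole_po_quot:
  assumes "o_ideal G P" "a \<in> carrier G" "b \<in> carrier G"
  shows "P #> a \<preceq>\<^bsub>po_quot G P\<^esub> P #> b \<longleftrightarrow> (\<exists>p\<in>P. a \<preceq> b \<otimes> p)"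
proof
  assume "P #> a \<preceq>\<^bsub>po_quot G P\<^esub> P #> b"
  then obtain p q where pq: "p \<in> P" "q \<in> P" and le: "a \<otimes> p \<preceq> b \<otimes> q"
    using assms by (auto simp: po_quot_def rcos_mem_iff)
  then have "a \<preceq> b \<otimes> (q \<otimes> inv p)"
    using le_mult_inv_iff[of a p "b \<otimes> q"] assms o_ideal_carrierD by (simp add: m_assoc)
  then show "\<exists>p\<in>P. a \<preceq> b \<otimes> p"
    using pq assms by (auto intro: o_ideal_mult o_ideal_inv)
next
  assume "\<exists>p\<in>P. a \<preceq> b \<otimes> p"
  then obtain p where "p \<in> P" "a \<preceq> b \<otimes> p" by blast
  moreover from this have "b \<otimes> p \<in> P #> b"
    using assms by (auto simp: rcos_mem_iff)
  ultimately show "P #> a \<preceq>\<^bsub>po_quot G P\<^esub> P #> b"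
    using rcos_self[OF assms(2) o_ideal_subgroup[OF assms(1)]] by (auto simp: po_quot_def)
qed

text \<open>Directedness of \<open>P\<close> allows a correction term to be raised above zero.
  Nonnegative corrections are what lifting an interval requires.\<close>

lemma pole_po_quot_pos:
  assumes "o_ideal G P" "a \<in> carrier G" "b \<in> carrier G"
    and "P #> a \<preceq>\<^bsub>po_quot G P\<^esub> P #> b"
  obtains p where "p \<in> P" "\<one> \<preceq> p" "a \<preceq> b \<otimes> p"
proof -
  obtain q where q: "q \<in> P" "a \<preceq> b \<otimes> q"
    using assms by (auto simp: pole_po_quot)
  obtain p where p: "p \<in> P" "q \<preceq> p" "\<one> \<preceq> p"
    using o_ideal_upper_pos assms(1) q(1) by blast
  have "b \<otimes> q \<preceq> b \<otimes> p"
    using p q assms o_ideal_carrierD by simp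
  then have "a \<preceq> b \<otimes> p"
    using p q assms o_ideal_carrierD pole_trans by (meson m_closed)
  with p that show thesis by blast
qed

lemma po_quot_mono:
  "\<lbrakk>o_ideal G P; a \<in> carrier G; b \<in> carrier G; a \<preceq> b\<rbrakk>
    \<Longrightarrow> P #> a \<preceq>\<^bsub>po_quot G P\<^esub> P #> b"
  using o_ideal_one by (force simp: pole_po_quot)

lemma abelian_po_group_po_quot:
  assumes P: "o_ideal G P"
  shows "abelian_po_group (po_quot G P)"
proof (rule abelian_po_groupI)
  show "comm_group (po_quot G P)"
  proof (rule comm_groupI)
    show "\<one>\<^bsub>po_quot G P\<^esub> \<in> carrier (po_quot G P)"
      using rcos_eq_ideal_iff[OF P, of \<one>] o_ideal_one[OF P] by (auto simp: carrier_po_quot image_iff)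
    show "\<one>\<^bsub>po_quot G P\<^esub> \<otimes>\<^bsub>po_quot G P\<^esub> A = A" if "A \<in> carrier (po_quot G P)" for A
      using that mult_po_quot[OF P, of \<one>] rcos_eq_ideal_iff[OF P, of \<one>] o_ideal_one[OF P]
      by (auto simp: carrier_po_quot)
    show "\<exists>B\<in>carrier (po_quot G P). B \<otimes>\<^bsub>po_quot G P\<^esub> A = \<one>\<^bsub>po_quot G P\<^esub>"
      if A: "A \<in> carrier (po_quot G P)" for A
    proof -
      obtain a where a: "a \<in> carrier G" "A = P #> a"
        using A by (auto simp: carrier_po_quot)
      then have "(P #> inv a) \<otimes>\<^bsub>po_quot G P\<^esub> A = \<one>\<^bsub>po_quot G P\<^esub>"
        using rcos_eq_ideal_iff[OF P, of \<one>] o_ideal_one[OF P] by (simp add: mult_po_quot[OF P])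
      with a show ?thesis by (auto simp: carrier_po_quot)
    qed
  qed (auto simp: carrier_po_quot mult_po_quot[OF P] m_ac)
  show "A \<preceq>\<^bsub>po_quot G P\<^esub> A" if "A \<in> carrier (po_quot G P)" for A
    using that by (auto simp: carrier_po_quot intro: po_quot_mono[OF P])
  show "A = B" if AB: "A \<in> carrier (po_quot G P)" "B \<in> carrier (po_quot G P)"
    "A \<preceq>\<^bsub>po_quot G P\<^esub> B" "B \<preceq>\<^bsub>po_quot G P\<^esub> A" for A B
  proof -
    obtain a b where ab: "a \<in> carrier G" "A = P #> a" "b \<in> carrier G" "B = P #> b"
      using AB by (auto simp: carrier_po_quot)
    obtain p q where pq: "p \<in> P" "q \<in> P" "a \<preceq> b \<otimes> p" "b \<preceq> a \<otimes> q"
      using AB ab by (auto simp: pole_po_quot[OF P])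
    note pqc = o_ideal_carrierD[OF P pq(1)] o_ideal_carrierD[OF P pq(2)]
    \<comment> \<open>Convexity enters here: a - b is squeezed between -q and p, both in
      \<open>P\<close>.\<close>
    have "a \<otimes> inv b \<preceq> p"
      using pq(3) ab pqc le_mult_inv_iff[of a "inv b" p] by (simp add: m_comm)
    moreover have "inv q \<preceq> a \<otimes> inv b"
      using pq(4) ab pqc le_mult_inv_iff[of b "inv q" a] le_mult_inv_iff[of "inv q" b a]
      by (simp add: m_comm)
    ultimately have "a \<otimes> inv b \<in> P"
      using ab pq o_ideal_convex[OF P] o_ideal_inv[OF P] by (meson inv_closed m_closed)
    moreover have "a = b \<otimes> (a \<otimes> inv b)"
      using ab by (simp add: m_lcomm[of b a])
    ultimately show ?thesis
      using ab rcos_eq_iff[OF P] by blast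
  qed
  show "A \<preceq>\<^bsub>po_quot G P\<^esub> C" if ABC: "A \<in> carrier (po_quot G P)" "B \<in> carrier (po_quot G P)"
    "C \<in> carrier (po_quot G P)" "A \<preceq>\<^bsub>po_quot G P\<^esub> B" "B \<preceq>\<^bsub>po_quot G P\<^esub> C" for A B C
  proof -
    obtain a b c where abc: "a \<in> carrier G" "A = P #> a" "b \<in> carrier G" "B = P #> b"
        "c \<in> carrier G" "C = P #> c"
      using ABC by (auto simp: carrier_po_quot)
    obtain p q where pq: "p \<in> P" "q \<in> P" "a \<preceq> b \<otimes> p" "b \<preceq> c \<otimes> q"
      using ABC abc by (auto simp: pole_po_quot[OF P])
    note pqc = o_ideal_carrierD[OF P pq(1)] o_ideal_carrierD[OF P pq(2)]
    have "b \<otimes> p \<preceq> c \<otimes> q \<otimes> p"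
      using pq(4) abc pqc by simp
    with pq(3) have "a \<preceq> c \<otimes> (q \<otimes> p)"
      using abc pqc pole_trans[of a "b \<otimes> p" "c \<otimes> q \<otimes> p"] by (simp add: m_assoc)
    then show ?thesis
      using abc pq o_ideal_mult[OF P] by (auto simp: pole_po_quot[OF P])
  qed
  show "C \<otimes>\<^bsub>po_quot G P\<^esub> A \<preceq>\<^bsub>po_quot G P\<^esub> C \<otimes>\<^bsub>po_quot G P\<^esub> B"
    if ABC: "A \<in> carrier (po_quot G P)" "B \<in> carrier (po_quot G P)"
    "C \<in> carrier (po_quot G P)" "A \<preceq>\<^bsub>po_quot G P\<^esub> B" for A B C
    using ABC o_ideal_carrierD[OF P]
    by (auto simp: carrier_po_quot mult_po_quot[OF P] pole_po_quot[OF P] m_assoc)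
qed

lemma po_quot_pos_representative:
  assumes P: "o_ideal G P" and A: "A \<in> pos_cone (po_quot G P)"
  obtains a where "a \<in> carrier G" "\<one> \<preceq> a" "A = P #> a"
proof -
  obtain a where a: "a \<in> carrier G" "A = P #> a"
    using A by (auto simp: pos_cone_def carrier_po_quot)
  have "P #> \<one> \<preceq>\<^bsub>po_quot G P\<^esub> P #> a"
    using A a rcos_eq_ideal_iff[OF P, of \<one>] o_ideal_one[OF P] by (simp add: pos_cone_def)
  then obtain p where p: "p \<in> P" "\<one> \<preceq> a \<otimes> p"
    using a by (auto simp: pole_po_quot[OF P])
  show thesis
  proof
    show "a \<otimes> p \<in> carrier G" "\<one> \<preceq> a \<otimes> p"
      using a p o_ideal_carrierD[OF P] by auto
    with a p show "A = P #> (a \<otimes> p)"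
      using rcos_eq_iff[OF P, of "a \<otimes> p" a] by auto
  qed
qed

lemma nat_pow_po_quot:
  assumes "o_ideal G P" "a \<in> carrier G"
  shows "(P #> a) [^]\<^bsub>po_quot G P\<^esub> (n::nat) = P #> (a [^] n)"
proof (induction n)
  case 0
  interpret Q: abelian_po_group "po_quot G P" by (rule abelian_po_group_po_quot) fact
  show ?case using rcos_eq_ideal_iff[of P \<one>] assms o_ideal_one by simp
next
  case (Suc n)
  interpret Q: abelian_po_group "po_quot G P" by (rule abelian_po_group_po_quot) fact
  show ?case using Suc assms by (simp add: mult_po_quot)
qed

lemma strong_unit_po_quot:
  assumes P: "o_ideal G P" and u: "strong_unit G u"
  shows "strong_unit (po_quot G P) (P #> u)"
proof -
  have uc: "u \<in> carrier G" "\<one> \<preceq> u"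
    using u by (auto simp: strong_unit_def pos_cone_def)
  have "P #> \<one> \<preceq>\<^bsub>po_quot G P\<^esub> P #> u"
    using uc by (intro po_quot_mono[OF P]) auto
  then have "P #> u \<in> pos_cone (po_quot G P)"
    using rcos_eq_ideal_iff[OF P, of \<one>] o_ideal_one[OF P] uc
    by (simp add: pos_cone_def carrier_po_quot)
  moreover have "\<exists>n::nat. A \<preceq>\<^bsub>po_quot G P\<^esub> (P #> u) [^]\<^bsub>po_quot G P\<^esub> n"
    if A: "A \<in> carrier (po_quot G P)" for A
  proof -
    obtain a where a: "a \<in> carrier G" "A = P #> a"
      using A by (auto simp: carrier_po_quot)
    then obtain n :: nat where "a \<preceq> u [^] n"
      using u unfolding strong_unit_def by blast
    then have "A \<preceq>\<^bsub>po_quot G P\<^esub> (P #> u) [^]\<^bsub>po_quot G P\<^esub> n"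
      using a uc by (simp add: nat_pow_po_quot[OF P] po_quot_mono[OF P])
    then show ?thesis by blast
  qed
  ultimately show ?thesis by (simp add: strong_unit_def)
qed

lemma directed_po_quot:
  assumes P: "o_ideal G P" and "directed G"
  shows "directed (po_quot G P)"
  unfolding directed_def
proof (intro ballI)
  fix A B assume "A \<in> carrier (po_quot G P)" "B \<in> carrier (po_quot G P)"
  then obtain a b where ab: "a \<in> carrier G" "A = P #> a" "b \<in> carrier G" "B = P #> b"
    by (auto simp: carrier_po_quot)
  then obtain c where "c \<in> carrier G" "a \<preceq> c" "b \<preceq> c"
    using assms(2) unfolding directed_def by blast
  with ab show "\<exists>C\<in>carrier (po_quot G P). A \<preceq>\<^bsub>po_quot G P\<^esub> C \<and> B \<preceq>\<^bsub>po_quot G P\<^esub> C"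
    by (intro bexI[of _ "P #> c"]) (auto simp: carrier_po_quot intro!: po_quot_mono[OF P])
qed

lemma interpolation_po_quot:
  assumes P: "o_ideal G P" and int: "interpolation G"
  shows "interpolation (po_quot G P)"
  unfolding interpolation_def
proof (intro ballI impI, elim conjE)
  fix A1 A2 B1 B2
  assume cl: "A1 \<in> carrier (po_quot G P)" "A2 \<in> carrier (po_quot G P)"
      "B1 \<in> carrier (po_quot G P)" "B2 \<in> carrier (po_quot G P)"
    and le: "A1 \<preceq>\<^bsub>po_quot G P\<^esub> B1" "A1 \<preceq>\<^bsub>po_quot G P\<^esub> B2"
      "A2 \<preceq>\<^bsub>po_quot G P\<^esub> B1" "A2 \<preceq>\<^bsub>po_quot G P\<^esub> B2"
  obtain a1 a2 b1 b2 where ab: "a1 \<in> carrier G" "A1 = P #> a1" "a2 \<in> carrier G" "A2 = P #> a2"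
      "b1 \<in> carrier G" "B1 = P #> b1" "b2 \<in> carrier G" "B2 = P #> b2"
    using cl by (auto simp: carrier_po_quot)
  obtain p11 p12 p21 p22 where p: "p11 \<in> P" "p12 \<in> P" "p21 \<in> P" "p22 \<in> P"
    and le': "a1 \<preceq> b1 \<otimes> p11" "a1 \<preceq> b2 \<otimes> p12" "a2 \<preceq> b1 \<otimes> p21" "a2 \<preceq> b2 \<otimes> p22"
    using le ab by (auto simp: pole_po_quot[OF P])
  \<comment> \<open>Each upper bound has received two corrections, one for each lower bound.
    Directedness of \<open>P\<close> merges them, so that b1 + p1 and b2 + p2, which still represent
    \<open>B1\<close> and \<open>B2\<close>, bound a1 and a2 in G itself.\<close>
  obtain p1 where p1: "p1 \<in> P" "p11 \<preceq> p1" "p21 \<preceq> p1"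
    using o_ideal_upper2[OF P p(1,3)] by blast
  obtain p2 where p2: "p2 \<in> P" "p12 \<preceq> p2" "p22 \<preceq> p2"
    using o_ideal_upper2[OF P p(2,4)] by blast
  have pc: "p11 \<in> carrier G" "p12 \<in> carrier G" "p21 \<in> carrier G" "p22 \<in> carrier G"
      "p1 \<in> carrier G" "p2 \<in> carrier G"
    using p p1 p2 o_ideal_carrierD[OF P] by auto
  have "a1 \<preceq> b1 \<otimes> p1" "a1 \<preceq> b2 \<otimes> p2" "a2 \<preceq> b1 \<otimes> p1" "a2 \<preceq> b2 \<otimes> p2"
    using le' p1(2,3) p2(2,3) pc ab(1,3,5,7)
    by (meson pole_trans mult_left_mono m_closed)+
  then obtain c where c: "c \<in> carrier G" "a1 \<preceq> c" "a2 \<preceq> c" "c \<preceq> b1 \<otimes> p1" "c \<preceq> b2 \<otimes> p2"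
    using int[unfolded interpolation_def, rule_format, of a1 a2 "b1 \<otimes> p1" "b2 \<otimes> p2"] ab pc by auto
  then show "\<exists>C\<in>carrier (po_quot G P). A1 \<preceq>\<^bsub>po_quot G P\<^esub> C \<and> A2 \<preceq>\<^bsub>po_quot G P\<^esub> C \<and>
      C \<preceq>\<^bsub>po_quot G P\<^esub> B1 \<and> C \<preceq>\<^bsub>po_quot G P\<^esub> B2"
    using ab p1 p2 po_quot_mono[OF P]
    by (intro bexI[of _ "P #> c"]) (auto simp: carrier_po_quot pole_po_quot[OF P, of c])
qed

end

section \<open>Prime o-ideals\<close>

context abelian_po_group
begin

lemma le_mult_posI:
  assumes "y \<preceq> a" "\<one> \<preceq> b" "y \<in> carrier G" "a \<in> carrier G" "b \<in> carrier G"
  shows "y \<preceq> a \<otimes> b"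
  using mult_mono[OF assms(1,2)] assms by simp

text \<open>\<open>Q\<close> is the o-ideal generated by \<open>P\<close> and a: every o-ideal
  containing both contains the bounds na + p and their negatives, hence by convexity all of
  \<open>Q\<close>. Bounding y and -y by the same expression makes closure under inverses
  immediate.\<close>

lemma o_ideal_adjoin:
  assumes P: "o_ideal G P" and a: "a \<in> carrier G" "\<one> \<preceq> a"
  defines "Q \<equiv> {y \<in> carrier G. \<exists>n::nat. \<exists>p\<in>P. \<one> \<preceq> p \<and> y \<preceq> a [^] n \<otimes> p \<and> inv y \<preceq> a [^] n \<otimes> p}"
  shows "o_ideal G Q" "P \<subseteq> Q" "a \<in> Q"
proof -
  note Pc = o_ideal_carrierD[OF P]
  have mult: "y \<otimes> z \<in> Q" if yz: "y \<in> Q" "z \<in> Q" for y z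
  proof -
    obtain n m :: nat and p q
      where *: "y \<in> carrier G" "z \<in> carrier G" "p \<in> P" "q \<in> P" "\<one> \<preceq> p" "\<one> \<preceq> q"
        "y \<preceq> a [^] n \<otimes> p" "inv y \<preceq> a [^] n \<otimes> p" "z \<preceq> a [^] m \<otimes> q" "inv z \<preceq> a [^] m \<otimes> q"
      using yz unfolding Q_def by blast
    have eq: "(a [^] n \<otimes> p) \<otimes> (a [^] m \<otimes> q) = a [^] (n + m) \<otimes> (p \<otimes> q)"
      using a * Pc by (simp add: nat_pow_mult[symmetric] m_ac)
    have "y \<otimes> z \<preceq> a [^] (n + m) \<otimes> (p \<otimes> q)"
      using mult_mono[OF *(7,9)] a * Pc by (simp add: eq)
    moreover have "inv (y \<otimes> z) \<preceq> a [^] (n + m) \<otimes> (p \<otimes> q)"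
      using mult_mono[OF *(8,10)] a * Pc by (simp add: eq inv_mult)
    moreover have "\<one> \<preceq> p \<otimes> q"
      using le_mult_posI[OF *(5,6)] * Pc by simp
    ultimately show ?thesis
      using * o_ideal_mult[OF P *(3,4)] unfolding Q_def by blast
  qed
  have inv: "inv y \<in> Q" if "y \<in> Q" for y
    using that unfolding Q_def by auto
  show PQ: "P \<subseteq> Q"
  proof
    fix y assume y: "y \<in> P"
    obtain p where p: "p \<in> P" "y \<preceq> p" "inv y \<preceq> p"
      using o_ideal_upper2[OF P y o_ideal_inv[OF P y]] .
    obtain q where q: "q \<in> P" "p \<preceq> q" "\<one> \<preceq> q"
      using o_ideal_upper_pos[OF P p(1)] .
    have "y \<preceq> a [^] (0::nat) \<otimes> q" "inv y \<preceq> a [^] (0::nat) \<otimes> q"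
      using p q y Pc pole_trans[of y p q] pole_trans[of "inv y" p q] by simp_all
    then show "y \<in> Q"
      using q y Pc unfolding Q_def by blast
  qed
  have "inv a \<preceq> a"
    using a le_mult_posI[of \<one> a a] by (simp add: inv_le_iff)
  then have "a \<preceq> a [^] (1::nat) \<otimes> \<one>" "inv a \<preceq> a [^] (1::nat) \<otimes> \<one>"
    using a by simp_all
  then show "a \<in> Q"
    using a o_ideal_one[OF P] pole_refl[OF one_closed] unfolding Q_def by blast
  show "o_ideal G Q"
    unfolding o_ideal_def
  proof (intro conjI ballI impI)
    show "subgroup Q G"
    proof
      show "Q \<subseteq> carrier G" by (auto simp: Q_def)
    qed (use mult inv PQ o_ideal_one[OF P] in blast)+
  next
    fix y z x assume yz: "y \<in> Q" "z \<in> Q" and x: "x \<in> carrier G" "y \<preceq> x" "x \<preceq> z"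
    obtain n m :: nat and p q
      where *: "y \<in> carrier G" "z \<in> carrier G" "p \<in> P" "q \<in> P" "\<one> \<preceq> p" "\<one> \<preceq> q"
        "inv y \<preceq> a [^] n \<otimes> p" "z \<preceq> a [^] m \<otimes> q"
      using yz unfolding Q_def by blast
    have pq: "\<one> \<preceq> p \<otimes> q" "p \<otimes> q \<in> P"
      using le_mult_posI[OF *(5,6)] * Pc o_ideal_mult[OF P] by simp_all
    have "\<one> \<preceq> a [^] n \<otimes> p" "\<one> \<preceq> a [^] m \<otimes> q"
      using a * Pc by (auto intro!: le_mult_posI nat_pow_pos)
    moreover have "(a [^] n \<otimes> p) \<otimes> (a [^] m \<otimes> q) = a [^] (n + m) \<otimes> (p \<otimes> q)"
      using a * Pc by (simp add: nat_pow_mult[symmetric] m_ac)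
    moreover have "inv x \<preceq> a [^] n \<otimes> p"
    proof -
      have "inv x \<preceq> inv y"
        using x * le_mult_inv_iff[of "inv x" y \<one>] by (simp add: inv_le_iff m_comm le_mult_inv_iff)
      then show ?thesis
        using * a Pc x by (meson pole_trans inv_closed m_closed nat_pow_closed)
    qed
    moreover have "x \<preceq> a [^] m \<otimes> q"
      using * a Pc x by (meson pole_trans inv_closed m_closed nat_pow_closed)
    \<comment> \<open>The bound for x comes from z and the bound for -x from y. Both bounds are
      nonnegative, so their sum is a common bound of the form demanded by \<open>Q\<close>.\<close>
    ultimately have "x \<preceq> a [^] (n + m) \<otimes> (p \<otimes> q)" "inv x \<preceq> a [^] (n + m) \<otimes> (p \<otimes> q)"
      using mult_mono[of \<one> "a [^] n \<otimes> p" x "a [^] m \<otimes> q"]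
        mult_mono[of "inv x" "a [^] n \<otimes> p" \<one> "a [^] m \<otimes> q"] * a Pc x by simp_all
    with pq x(1) show "x \<in> Q"
      unfolding Q_def by blast
  next
    fix y z assume yz: "y \<in> Q" "z \<in> Q"
    obtain n m :: nat and p q
      where *: "y \<in> carrier G" "z \<in> carrier G" "p \<in> P" "q \<in> P" "\<one> \<preceq> p" "\<one> \<preceq> q"
        "y \<preceq> a [^] n \<otimes> p" "z \<preceq> a [^] m \<otimes> q"
      using yz unfolding Q_def by blast
    have pos: "\<one> \<preceq> a [^] n \<otimes> p" "\<one> \<preceq> a [^] m \<otimes> q"
      using a * Pc by (auto intro!: le_mult_posI nat_pow_pos)
    \<comment> \<open>A bound na + p is nonnegative, so its negative lies below it and it is its own
      witness for membership. Sums of bounds are therefore upper bounds inside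
      \<open>Q\<close>.\<close>
    have self: "a [^] k \<otimes> r \<in> Q" if r: "r \<in> P" "\<one> \<preceq> r" for k :: nat and r
    proof -
      have "\<one> \<preceq> a [^] k \<otimes> r" "a [^] k \<otimes> r \<in> carrier G"
        using a r Pc by (auto intro!: le_mult_posI nat_pow_pos)
      moreover from this have "inv (a [^] k \<otimes> r) \<preceq> a [^] k \<otimes> r"
        using le_mult_posI[of \<one> "a [^] k \<otimes> r" "a [^] k \<otimes> r"] by (simp add: inv_le_iff)
      ultimately show ?thesis
        using r pole_refl unfolding Q_def by blast
    qed
    show "\<exists>c\<in>Q. y \<preceq> c \<and> z \<preceq> c"
    proof (intro bexI conjI)
      show "(a [^] n \<otimes> p) \<otimes> (a [^] m \<otimes> q) \<in> Q"
        using * by (intro mult self)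
      show "y \<preceq> (a [^] n \<otimes> p) \<otimes> (a [^] m \<otimes> q)" "z \<preceq> (a [^] n \<otimes> p) \<otimes> (a [^] m \<otimes> q)"
        using mult_mono[OF *(7) pos(2)] mult_mono[OF pos(1) *(8)] * a Pc by simp_all
    qed
  qed
qed

lemma o_ideal_Union_chain:
  assumes "C \<noteq> {}" "\<And>P. P \<in> C \<Longrightarrow> o_ideal G P" "\<And>P Q. \<lbrakk>P \<in> C; Q \<in> C\<rbrakk> \<Longrightarrow> P \<subseteq> Q \<or> Q \<subseteq> P"
  shows "o_ideal G (\<Union>C)"
proof -
  have two: "\<exists>P\<in>C. a \<in> P \<and> b \<in> P" if "a \<in> \<Union>C" "b \<in> \<Union>C" for a b
    using that assms(3) by blast
  show ?thesis
    unfolding o_ideal_def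
  proof (intro conjI ballI impI)
    show "subgroup (\<Union>C) G"
    proof
      show "\<Union>C \<subseteq> carrier G" using assms(2) o_ideal_carrierD by blast
      show "\<one> \<in> \<Union>C" using assms(1,2) o_ideal_one by blast
      show "inv x \<in> \<Union>C" if "x \<in> \<Union>C" for x using that assms(2) o_ideal_inv by blast
      show "x \<otimes> y \<in> \<Union>C" if "x \<in> \<Union>C" "y \<in> \<Union>C" for x y
        using two[OF that] assms(2) o_ideal_mult by blast
    qed
    show "x \<in> \<Union>C" if ab: "a \<in> \<Union>C" "b \<in> \<Union>C" "x \<in> carrier G" "a \<preceq> x" "x \<preceq> b" for a b x
    proof -
      obtain P where "P \<in> C" "a \<in> P" "b \<in> P" using two[OF ab(1,2)] by blast
      then show ?thesis using o_ideal_convex[OF assms(2) ab(4,5)] ab(3) by blast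
    qed
    show "\<exists>c\<in>\<Union>C. a \<preceq> c \<and> b \<preceq> c" if ab: "a \<in> \<Union>C" "b \<in> \<Union>C" for a b
    proof -
      obtain P where P: "P \<in> C" "a \<in> P" "b \<in> P" using two[OF ab] by blast
      obtain c where "c \<in> P" "a \<preceq> c" "b \<preceq> c" using o_ideal_upper2[OF assms(2)[OF P(1)] P(2,3)] .
      then show ?thesis using P(1) by blast
    qed
  qed
qed

lemma prime_o_ideal_exists:
  assumes x: "x \<in> carrier G" "\<not> \<one> \<preceq> x"
  obtains P where "o_ideal G P" "po_prime (po_quot G P)" "\<not> P \<preceq>\<^bsub>po_quot G P\<^esub> P #> x"
proof -
  \<comment> \<open>Non-positivity of the coset of x is spelled out with elements of
    \<open>P\<close>; in this form it passes to unions of chains immediately.\<close>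
  define \<A> where "\<A> = {P. o_ideal G P \<and> \<not> (\<exists>p\<in>P. \<one> \<preceq> x \<otimes> p)}"
  have "{\<one>} \<in> \<A>"
    using x o_ideal_singleton by (simp add: \<A>_def)
  then have "\<A> \<noteq> {}" by blast
  moreover have "\<Union>C \<in> \<A>" if C: "C \<noteq> {}" "subset.chain \<A> C" for C
  proof -
    have "o_ideal G (\<Union>C)"
      using C(2) by (intro o_ideal_Union_chain[OF C(1)]) (auto simp: \<A>_def subset_chain_def)
    then show ?thesis
      using C(2) by (auto simp: \<A>_def subset_chain_def)
  qed
  ultimately obtain P where P: "P \<in> \<A>" and max: "\<And>Q. Q \<in> \<A> \<Longrightarrow> P \<subseteq> Q \<Longrightarrow> Q = P"
    using subset_Zorn_nonempty[of \<A>] by blast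
  then have id: "o_ideal G P" and none: "\<not> (\<exists>p\<in>P. \<one> \<preceq> x \<otimes> p)"
    by (auto simp: \<A>_def)
  interpret Q: abelian_po_group "po_quot G P"
    by (rule abelian_po_group_po_quot[OF id])
  have P_coset: "P #> \<one> = P"
    using rcos_eq_ideal_iff[OF id, of \<one>] o_ideal_one[OF id] by simp
  have not_pos: "\<not> P \<preceq>\<^bsub>po_quot G P\<^esub> P #> x"
    using pole_po_quot[OF id, of \<one> x] x none by (simp add: P_coset)
  have inv_x: "inv\<^bsub>po_quot G P\<^esub> (P #> x) = P #> inv x"
    using x by (intro Q.inv_equality) (auto simp: mult_po_quot[OF id] carrier_po_quot P_coset)
  have bound: "\<exists>n::nat. P #> inv x \<preceq>\<^bsub>po_quot G P\<^esub> A [^]\<^bsub>po_quot G P\<^esub> n"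
    if A: "A \<in> pos_cone (po_quot G P)" "A \<noteq> P" for A
  proof -
    obtain a where a: "a \<in> carrier G" "\<one> \<preceq> a" "A = P #> a"
      using po_quot_pos_representative[OF id A(1)] .
    define Q where "Q = {y \<in> carrier G. \<exists>n::nat. \<exists>p\<in>P. \<one> \<preceq> p \<and> y \<preceq> a [^] n \<otimes> p \<and> inv y \<preceq> a [^] n \<otimes> p}"
    have Q: "o_ideal G Q" "P \<subseteq> Q" "a \<in> Q"
      unfolding Q_def using o_ideal_adjoin[OF id a(1,2)] by blast+
    have "Q \<noteq> P"
      using Q(3) A(2) a rcos_eq_ideal_iff[OF id a(1)] by blast
    \<comment> \<open>The o-ideal \<open>Q\<close> generated by \<open>P\<close> and a is strictly
      larger than \<open>P\<close>, so x is nonnegative modulo \<open>Q\<close>: some y in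
      \<open>Q\<close> satisfies -x <= y, and the bound on y bounds -x by a multiple of a modulo
      \<open>P\<close>.\<close>
    with max Q have "Q \<notin> \<A>" by blast
    then obtain y where "y \<in> Q" "\<one> \<preceq> x \<otimes> y"
      using Q(1) by (auto simp: \<A>_def)
    then obtain n :: nat and p where y: "y \<in> carrier G" "p \<in> P" "y \<preceq> a [^] n \<otimes> p" "inv x \<preceq> y"
      using x by (auto simp: Q_def inv_le_iff)
    have "inv x \<preceq> a [^] n \<otimes> p"
      using pole_trans[OF y(4,3)] y a x o_ideal_carrierD[OF id] by simp
    then have "P #> inv x \<preceq>\<^bsub>po_quot G P\<^esub> P #> a [^] n"
      using a x y by (auto simp: pole_po_quot[OF id])
    then show ?thesis
      using a nat_pow_po_quot[OF id] by auto
  qed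
  have "po_prime (po_quot G P)"
    unfolding po_prime_def one_po_quot
  proof (intro allI impI, rule ccontr)
    fix A B assume orth: "orthogonal (po_quot G P) A B" and "\<not> (A = P \<or> B = P)"
    then obtain n m :: nat where "P #> inv x \<preceq>\<^bsub>po_quot G P\<^esub> A [^]\<^bsub>po_quot G P\<^esub> n"
        "P #> inv x \<preceq>\<^bsub>po_quot G P\<^esub> B [^]\<^bsub>po_quot G P\<^esub> m"
      using bound by (metis orthogonal_def)
    then have "P #> inv x \<preceq>\<^bsub>po_quot G P\<^esub> P"
      using Q.orthogonal_pow[OF orth, of "P #> inv x" n m] x by (simp add: carrier_po_quot)
    then have "P \<preceq>\<^bsub>po_quot G P\<^esub> P #> x"
      using Q.inv_le_iff[of "P #> x" P] x P_coset Q.one_closed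
      by (simp add: inv_x carrier_po_quot mult_po_quot[OF id, of _ \<one>, simplified P_coset])
    with not_pos show False ..
  qed
  with id not_pos that show thesis by blast
qed

lemma prime_o_ideal_separating:
  assumes ab: "a \<in> carrier G" "b \<in> carrier G" "\<not> a \<preceq> b"
  obtains P where "o_ideal G P" "po_prime (po_quot G P)" "\<not> P #> a \<preceq>\<^bsub>po_quot G P\<^esub> P #> b"
proof -
  have shift: "a \<preceq> b \<otimes> p \<longleftrightarrow> \<one> \<preceq> (b \<otimes> inv a) \<otimes> p" if "p \<in> carrier G" for p
    using ab that le_mult_inv_iff[of \<one> a "b \<otimes> p"] by (simp add: m_ac)
  have "\<not> \<one> \<preceq> b \<otimes> inv a"
    using ab by (simp add: le_mult_inv_iff)
  then obtain P where P: "o_ideal G P" "po_prime (po_quot G P)"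
      "\<not> P \<preceq>\<^bsub>po_quot G P\<^esub> P #> (b \<otimes> inv a)"
    using prime_o_ideal_exists[of "b \<otimes> inv a"] ab by auto
  then have "\<not> P #> \<one> \<preceq>\<^bsub>po_quot G P\<^esub> P #> (b \<otimes> inv a)"
    using rcos_eq_ideal_iff[OF P(1), of \<one>] o_ideal_one[OF P(1)] by simp
  then have "\<not> P #> a \<preceq>\<^bsub>po_quot G P\<^esub> P #> b"
    using ab shift o_ideal_carrierD[OF P(1)] by (simp add: pole_po_quot[OF P(1)])
  with P that show thesis by blast
qed

text \<open>This is what makes projections of intervals surjective. A nonnegative representative a
  satisfies only a <= u + q with q in \<open>P\<close>, and a - q need not be nonnegative.
  Interpolating c between 0, a - q and a, u repairs both ends at once: 0 <= a - c <= q puts a - c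
  into \<open>P\<close> by convexity, so c represents the same coset.\<close>

lemma po_quot_interval_representative:
  assumes int: "interpolation G" and P: "o_ideal G P" and u: "u \<in> pos_cone G"
    and A: "A \<in> pos_cone (po_quot G P)" "A \<preceq>\<^bsub>po_quot G P\<^esub> P #> u"
  obtains a where "a \<in> carrier G" "\<one> \<preceq> a" "a \<preceq> u" "A = P #> a"
proof -
  have uc: "u \<in> carrier G" "\<one> \<preceq> u"
    using u by (auto simp: pos_cone_def)
  obtain a where a: "a \<in> carrier G" "\<one> \<preceq> a" "A = P #> a"
    using po_quot_pos_representative[OF P A(1)] .
  obtain q where q: "q \<in> P" "\<one> \<preceq> q" "a \<preceq> u \<otimes> q"
    using pole_po_quot_pos[OF P] A(2) a uc by metis
  have qc: "q \<in> carrier G"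
    using o_ideal_carrierD[OF P q(1)] .
  have "a \<otimes> inv q \<preceq> a" "a \<otimes> inv q \<preceq> u"
    using a q qc uc by (simp_all add: mult_inv_le_iff)
  then obtain c where c: "c \<in> carrier G" "\<one> \<preceq> c" "a \<otimes> inv q \<preceq> c" "c \<preceq> a" "c \<preceq> u"
    using int[unfolded interpolation_def, rule_format, of \<one> "a \<otimes> inv q" a u] a qc uc by auto
  obtain p where p: "p \<in> carrier G" "\<one> \<preceq> p" "a = c \<otimes> p"
    using leE[OF c(4)] a c by blast
  have "p \<preceq> q"
    using c a qc p by (simp add: mult_inv_le_iff)
  then have "p \<in> P"
    using o_ideal_convex[OF P p(2) _ o_ideal_one[OF P] q(1) p(1)] by blast
  then have "A = P #> c"
    using a p c rcos_eq_iff[OF P, of a c] by auto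
  with c that show thesis by blast
qed

lemma po_quot_singleton:
  "\<lbrakk>a \<in> carrier G; b \<in> carrier G\<rbrakk> \<Longrightarrow> {a} \<preceq>\<^bsub>po_quot G {\<one>}\<^esub> {b} \<longleftrightarrow> a \<preceq> b"
  by (simp add: po_quot_def)

section \<open>Interval effect algebras\<close>

lemma carrier_Gamma: "carrier (Gamma G u) = {g \<in> carrier G. \<one> \<preceq> g \<and> g \<preceq> u}"
  by (simp add: Gamma_def)

lemma psum_Gamma:
  "\<lbrakk>a \<in> carrier G; b \<in> carrier G; u \<in> carrier G\<rbrakk>
    \<Longrightarrow> psum (Gamma G u) a b = (if a \<otimes> b \<preceq> u then Some (a \<otimes> b) else None)"
  by (simp add: Gamma_def le_mult_inv_iff)

lemma eff_le_Gamma: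
  assumes u: "u \<in> carrier G" and ab: "a \<in> carrier (Gamma G u)" "b \<in> carrier (Gamma G u)"
  shows "eff_le (Gamma G u) a b \<longleftrightarrow> a \<preceq> b"
proof
  assume "eff_le (Gamma G u) a b"
  then show "a \<preceq> b"
    using u ab by (auto simp: eff_le_def carrier_Gamma psum_Gamma split: if_splits)
next
  assume "a \<preceq> b"
  then obtain c where c: "c \<in> carrier G" "\<one> \<preceq> c" "b = a \<otimes> c"
    using leE ab by (auto simp: carrier_Gamma)
  have "c \<preceq> u"
    using c ab u pole_trans[of c "a \<otimes> c" u] by (simp add: carrier_Gamma)
  then show "eff_le (Gamma G u) a b"
    unfolding eff_le_def using c ab u
    by (intro bexI[of _ c]) (auto simp: carrier_Gamma psum_Gamma)
qed

lemma effect_algebra_Gamma: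
  assumes "u \<in> pos_cone G"
  shows "effect_algebra (Gamma G u)"
proof
  have u: "u \<in> carrier G" "\<one> \<preceq> u"
    using assms by (auto simp: pos_cone_def)
  have e: "ezero (Gamma G u) = \<one>" "eone (Gamma G u) = u"
    by (simp_all add: Gamma_def)
  show "ezero (Gamma G u) \<in> carrier (Gamma G u)" "eone (Gamma G u) \<in> carrier (Gamma G u)"
    using u by (simp_all add: e carrier_Gamma)
  show "c \<in> carrier (Gamma G u)"
    if "a \<in> carrier (Gamma G u)" "b \<in> carrier (Gamma G u)" "psum (Gamma G u) a b = Some c" for a b c
    using that u le_mult_posI[of \<one> a b]
    by (auto simp: carrier_Gamma psum_Gamma split: if_splits)
  show "psum (Gamma G u) a b = psum (Gamma G u) b a"
    if "a \<in> carrier (Gamma G u)" "b \<in> carrier (Gamma G u)" for a b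
    using that u by (simp add: carrier_Gamma psum_Gamma m_comm)
  show "Option.bind (psum (Gamma G u) a b) (\<lambda>x. psum (Gamma G u) x c) =
      Option.bind (psum (Gamma G u) b c) (psum (Gamma G u) a)"
    if "a \<in> carrier (Gamma G u)" "b \<in> carrier (Gamma G u)" "c \<in> carrier (Gamma G u)" for a b c
  proof -
    have cl: "a \<in> carrier G" "b \<in> carrier G" "c \<in> carrier G" "\<one> \<preceq> a" "\<one> \<preceq> c"
      using that by (auto simp: carrier_Gamma)
    \<comment> \<open>Both partial sums lie below the full sum, so either bracketing is defined
      exactly if a + b + c <= u.\<close>
    have "a \<otimes> b \<preceq> a \<otimes> (b \<otimes> c)" "b \<otimes> c \<preceq> a \<otimes> (b \<otimes> c)"
      using cl by simp_all
    then have "a \<otimes> (b \<otimes> c) \<preceq> u \<Longrightarrow> a \<otimes> b \<preceq> u" "a \<otimes> (b \<otimes> c) \<preceq> u \<Longrightarrow> b \<otimes> c \<preceq> u"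
      using cl u pole_trans by (meson m_closed)+
    then show ?thesis
      using cl u by (auto simp: psum_Gamma m_assoc)
  qed
  show "\<exists>!x. x \<in> carrier (Gamma G u) \<and> psum (Gamma G u) a x = Some (eone (Gamma G u))"
    if "a \<in> carrier (Gamma G u)" for a
  proof -
    have a: "a \<in> carrier G" "\<one> \<preceq> a" "a \<preceq> u"
      using that by (auto simp: carrier_Gamma)
    obtain x where x: "x \<in> carrier G" "\<one> \<preceq> x" "u = a \<otimes> x"
      using leE[OF a(3)] a u by blast
    then have "x \<preceq> u"
      using a by simp
    then show ?thesis
      unfolding e using x a u
      by (intro ex1I[of _ x]) (auto simp: e carrier_Gamma psum_Gamma split: if_splits)
  qed
  show "a = ezero (Gamma G u)"
    if "a \<in> carrier (Gamma G u)" "psum (Gamma G u) a (eone (Gamma G u)) \<noteq> None" for a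
  proof -
    have "a \<in> carrier G" "\<one> \<preceq> a" "a \<otimes> u \<preceq> u"
      using that u by (auto simp: e carrier_Gamma psum_Gamma split: if_splits)
    then show ?thesis
      using u pole_antisym[of a \<one>] by (simp add: e)
  qed
qed

lemma eff_RDP_Gamma:
  assumes "u \<in> carrier G" "group_RDP G"
  shows "eff_RDP (Gamma G u)"
  unfolding eff_RDP_def
proof (intro ballI allI impI, elim conjE)
  fix a1 a2 b1 b2 s
  assume "a1 \<in> carrier (Gamma G u)" "a2 \<in> carrier (Gamma G u)"
    "b1 \<in> carrier (Gamma G u)" "b2 \<in> carrier (Gamma G u)"
    and s: "psum (Gamma G u) a1 a2 = Some s" "psum (Gamma G u) b1 b2 = Some s"
  then have cl: "a1 \<in> carrier G" "a2 \<in> carrier G" "b1 \<in> carrier G" "b2 \<in> carrier G"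
    and pos: "\<one> \<preceq> a1" "\<one> \<preceq> a2" "\<one> \<preceq> b1" "\<one> \<preceq> b2"
    and le: "a1 \<preceq> u" "a2 \<preceq> u" "b1 \<preceq> u" "b2 \<preceq> u"
    by (auto simp: carrier_Gamma)
  have "a1 \<otimes> a2 = b1 \<otimes> b2"
    using s cl assms(1) by (auto simp: psum_Gamma split: if_splits)
  then obtain c11 c12 c21 c22
    where c: "c11 \<in> pos_cone G" "c12 \<in> pos_cone G" "c21 \<in> pos_cone G" "c22 \<in> pos_cone G"
      and eq: "a1 = c11 \<otimes> c12" "a2 = c21 \<otimes> c22" "b1 = c11 \<otimes> c21" "b2 = c12 \<otimes> c22"
    using assms(2)[unfolded group_RDP_def, rule_format, of a1 a2 b1 b2] cl pos
    by (auto simp: pos_cone_def)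
  note c' = c[unfolded pos_cone_def, simplified]
  have "c11 \<preceq> a1" "c12 \<preceq> a1" "c21 \<preceq> a2" "c22 \<preceq> a2"
    using c' by (simp_all add: eq(1,2))
  then have "c11 \<preceq> u" "c12 \<preceq> u" "c21 \<preceq> u" "c22 \<preceq> u"
    using le(1,2) c' cl assms(1) pole_trans by meson+
  then show "\<exists>c11\<in>carrier (Gamma G u). \<exists>c12\<in>carrier (Gamma G u).
      \<exists>c21\<in>carrier (Gamma G u). \<exists>c22\<in>carrier (Gamma G u).
        psum (Gamma G u) c11 c12 = Some a1 \<and> psum (Gamma G u) c21 c22 = Some a2 \<and>
        psum (Gamma G u) c11 c21 = Some b1 \<and> psum (Gamma G u) c12 c22 = Some b2"
    using c' le assms(1) eq
    by (intro bexI[of _ c11] bexI[of _ c12] bexI[of _ c21] bexI[of _ c22])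
      (auto simp: carrier_Gamma psum_Gamma)
qed

text \<open>For an infimum i the differences x - i and y - i should be orthogonal, but i is greatest
  only among lower bounds inside the interval, whereas orthogonality tests all z in the group.
  Interpolation replaces z by some w above 0 and z and below both differences; then i + w is a lower
  bound in the interval, and i + w <= i forces w <= 0. For a supremum s the same works with s - x, s
  - y and the upper bound s - w.\<close>

lemma antilattice_Gamma:
  assumes u: "u \<in> carrier G" and int: "interpolation G" and prime: "po_prime G"
  shows "antilattice (eff_order (Gamma G u))"
proof -
  have le: "le (eff_order (Gamma G u)) a b \<longleftrightarrow> a \<preceq> b"
    if "a \<in> carrier G" "\<one> \<preceq> a" "a \<preceq> u" "b \<in> carrier G" "\<one> \<preceq> b" "b \<preceq> u" for a b
    using that eff_le_Gamma[OF u, of a b] by (simp add: eff_order_def carrier_Gamma)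
  have car: "carrier (eff_order (Gamma G u)) = {g \<in> carrier G. \<one> \<preceq> g \<and> g \<preceq> u}"
    by (simp add: eff_order_def carrier_Gamma)
  show ?thesis
    unfolding antilattice_def
  proof (intro ballI impI, elim disjE exE)
    fix x y i
    assume "x \<in> carrier (eff_order (Gamma G u))" "y \<in> carrier (eff_order (Gamma G u))"
      and i: "greatest (eff_order (Gamma G u)) i (Lower (eff_order (Gamma G u)) {x, y})"
    then have x: "x \<in> carrier G" "\<one> \<preceq> x" "x \<preceq> u" and y: "y \<in> carrier G" "\<one> \<preceq> y" "y \<preceq> u"
      by (auto simp: car)
    have ic: "i \<in> carrier G" "\<one> \<preceq> i" "i \<preceq> u" "i \<preceq> x" "i \<preceq> y"
      using i x y le by (auto simp: greatest_def Lower_def car)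
    have max: "z \<preceq> i" if "z \<in> carrier G" "\<one> \<preceq> z" "z \<preceq> u" "z \<preceq> x" "z \<preceq> y" for z
      using i x y ic that le by (auto simp: greatest_def Lower_def car)
    obtain p where p: "p \<in> carrier G" "\<one> \<preceq> p" "x = i \<otimes> p" using leE[OF ic(4)] x ic by blast
    obtain q where q: "q \<in> carrier G" "\<one> \<preceq> q" "y = i \<otimes> q" using leE[OF ic(5)] y ic by blast
    have "orthogonal G p q"
      unfolding orthogonal_def pos_cone_def
    proof (intro conjI ballI impI)
      fix z assume z: "z \<in> carrier G" and "z \<preceq> p \<and> z \<preceq> q"
      then obtain w where w: "w \<in> carrier G" "\<one> \<preceq> w" "z \<preceq> w" "w \<preceq> p" "w \<preceq> q"
        using int[unfolded interpolation_def, rule_format, of \<one> z p q] p q by auto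
      have "i \<otimes> w \<preceq> x" "i \<otimes> w \<preceq> y" "\<one> \<preceq> i \<otimes> w"
        using w p q ic by (simp_all add: le_mult_posI)
      then have "w \<preceq> \<one>"
        using max[of "i \<otimes> w"] pole_trans[of "i \<otimes> w" x u] w ic x u by simp
      then show "z \<preceq> \<one>"
        using pole_trans[OF w(3)] z w by simp
    qed (use p q in auto)
    then have "p = \<one> \<or> q = \<one>"
      using prime by (auto simp: po_prime_def)
    then have "x \<preceq> y \<or> y \<preceq> x"
      using ic p q by auto
    then show "le (eff_order (Gamma G u)) x y \<or> le (eff_order (Gamma G u)) y x"
      using le x y by simp
  next
    fix x y s
    assume "x \<in> carrier (eff_order (Gamma G u))" "y \<in> carrier (eff_order (Gamma G u))"
      and s: "least (eff_order (Gamma G u)) s (Upper (eff_order (Gamma G u)) {x, y})"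
    then have x: "x \<in> carrier G" "\<one> \<preceq> x" "x \<preceq> u" and y: "y \<in> carrier G" "\<one> \<preceq> y" "y \<preceq> u"
      by (auto simp: car)
    have sc: "s \<in> carrier G" "\<one> \<preceq> s" "s \<preceq> u" "x \<preceq> s" "y \<preceq> s"
      using s x y le by (auto simp: least_def Upper_def car)
    have min: "s \<preceq> z" if "z \<in> carrier G" "\<one> \<preceq> z" "z \<preceq> u" "x \<preceq> z" "y \<preceq> z" for z
      using s x y sc that le by (auto simp: least_def Upper_def car)
    obtain p where p: "p \<in> carrier G" "\<one> \<preceq> p" "s = x \<otimes> p" using leE[OF sc(4)] x sc by blast
    obtain q where q: "q \<in> carrier G" "\<one> \<preceq> q" "s = y \<otimes> q" using leE[OF sc(5)] y sc by blast
    have "orthogonal G p q"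
      unfolding orthogonal_def pos_cone_def
    proof (intro conjI ballI impI)
      fix z assume z: "z \<in> carrier G" and "z \<preceq> p \<and> z \<preceq> q"
      then obtain w where w: "w \<in> carrier G" "\<one> \<preceq> w" "z \<preceq> w" "w \<preceq> p" "w \<preceq> q"
        using int[unfolded interpolation_def, rule_format, of \<one> z p q] p q by auto
      have xs: "x \<preceq> s \<otimes> inv w" "y \<preceq> s \<otimes> inv w"
        using w p q x y sc mult_left_le_iff[of w p x] mult_left_le_iff[of w q y]
        by (simp_all add: le_mult_inv_iff)
      moreover have "\<one> \<preceq> s \<otimes> inv w"
        using pole_trans[OF x(2) xs(1)] x sc w by simp
      moreover have "s \<otimes> inv w \<preceq> u"
        using le_mult_posI[OF sc(3) w(2)] sc w u by (simp add: mult_inv_le_iff)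
      ultimately have "w \<preceq> \<one>"
        using min[of "s \<otimes> inv w"] sc w by simp
      then show "z \<preceq> \<one>"
        using pole_trans[OF w(3)] z w by simp
    qed (use p q in auto)
    then have "p = \<one> \<or> q = \<one>"
      using prime by (auto simp: po_prime_def)
    then have "x \<preceq> y \<or> y \<preceq> x"
      using sc p q x y by auto
    then show "le (eff_order (Gamma G u)) x y \<or> le (eff_order (Gamma G u)) y x"
      using le x y by simp
  qed
qed

end

section \<open>Homomorphisms and subdirect products of effect algebras\<close>

lemma eff_hom_Gamma:
  assumes "abelian_po_group G" "abelian_po_group M" and h: "h \<in> hom G M"
    and mono: "\<And>a b. \<lbrakk>a \<in> carrier G; b \<in> carrier G; a \<preceq>\<^bsub>G\<^esub> b\<rbrakk> \<Longrightarrow> h a \<preceq>\<^bsub>M\<^esub> h b"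
    and u: "u \<in> carrier G"
  shows "eff_hom (Gamma G u) (Gamma M (h u)) h"
proof -
  interpret G: abelian_po_group G by fact
  interpret M: abelian_po_group M by fact
  have h1: "h \<one>\<^bsub>G\<^esub> = \<one>\<^bsub>M\<^esub>"
    using hom_one[OF h] G.is_group M.is_group by blast
  have hc: "h a \<in> carrier M" if "a \<in> carrier G" for a
    using hom_in_carrier[OF h that] .
  have hm: "h (a \<otimes>\<^bsub>G\<^esub> b) = h a \<otimes>\<^bsub>M\<^esub> h b" if "a \<in> carrier G" "b \<in> carrier G" for a b
    using hom_mult[OF h that] .
  have "h a \<in> carrier (Gamma M (h u))" if "a \<in> carrier (Gamma G u)" for a
    using that u mono[of "\<one>\<^bsub>G\<^esub>" a] mono[of a u] hc
    by (auto simp: G.carrier_Gamma M.carrier_Gamma h1)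
  moreover have "psum (Gamma M (h u)) (h a) (h b) = Some (h c)"
    if "a \<in> carrier (Gamma G u)" "b \<in> carrier (Gamma G u)" "psum (Gamma G u) a b = Some c" for a b c
    using that u mono[of "a \<otimes>\<^bsub>G\<^esub> b" u] hc
    by (auto simp: G.carrier_Gamma G.psum_Gamma M.psum_Gamma hm[symmetric] split: if_splits)
  ultimately show ?thesis
    by (auto simp: eff_hom_def Gamma_def)
qed

lemma eff_hom_le:
  "\<lbrakk>eff_hom E F h; a \<in> carrier E; b \<in> carrier E; eff_le E a b\<rbrakk> \<Longrightarrow> eff_le F (h a) (h b)"
  unfolding eff_le_def eff_hom_def by (metis Pi_mem)

text \<open>Homomorphisms are monotone by \<open>eff_hom_le\<close>, so of the order condition only
  reflection remains as a premise. The map into the product is restricted to \<open>I\<close>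
  because the product consists of extensional functions.\<close>

lemma subdirect_productI:
  assumes hom: "\<And>i. i \<in> I \<Longrightarrow> eff_hom E (F i) (\<phi> i)"
    and surj: "\<And>i. i \<in> I \<Longrightarrow> \<phi> i ` carrier E = carrier (F i)"
    and inj: "\<And>a b. \<lbrakk>a \<in> carrier E; b \<in> carrier E; \<And>i. i \<in> I \<Longrightarrow> \<phi> i a = \<phi> i b\<rbrakk> \<Longrightarrow> a = b"
    and refl: "\<And>a b. \<lbrakk>a \<in> carrier E; b \<in> carrier E; \<And>i. i \<in> I \<Longrightarrow> eff_le (F i) (\<phi> i a) (\<phi> i b)\<rbrakk>
      \<Longrightarrow> eff_le E a b"
  shows "subdirect_product E I F"
  unfolding subdirect_product_def
proof (intro exI conjI ballI)
  let ?f = "\<lambda>a. \<lambda>i\<in>I. \<phi> i a"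
  have cl: "?f a \<in> carrier (eff_prod I F)" if a: "a \<in> carrier E" for a
  proof -
    have "\<phi> i a \<in> carrier (F i)" if "i \<in> I" for i
      using hom[OF that] a by (auto simp: eff_hom_def)
    then show ?thesis by (simp add: eff_prod_def)
  qed
  show "eff_hom E (eff_prod I F) ?f"
    unfolding eff_hom_def
  proof (intro conjI ballI allI impI)
    show "?f \<in> carrier E \<rightarrow> carrier (eff_prod I F)" using cl by blast
    show "?f (eone E) = eone (eff_prod I F)"
      using hom by (auto simp: eff_prod_def eff_hom_def)
    fix a b c assume "a \<in> carrier E" "b \<in> carrier E" "psum E a b = Some c"
    then have "\<And>i. i \<in> I \<Longrightarrow> psum (F i) (\<phi> i a) (\<phi> i b) = Some (\<phi> i c)"
      using hom by (simp add: eff_hom_def)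
    then show "psum (eff_prod I F) (?f a) (?f b) = Some (?f c)"
      by (auto simp: eff_prod_def)
  qed
  show "inj_on ?f (carrier E)"
  proof (rule inj_onI)
    fix a b assume ab: "a \<in> carrier E" "b \<in> carrier E" and eq: "?f a = ?f b"
    have "\<phi> i a = \<phi> i b" if "i \<in> I" for i
      using fun_cong[OF eq, of i] that by simp
    then show "a = b" by (rule inj[OF ab])
  qed
  show "eff_le (eff_prod I F) (?f a) (?f b) = eff_le E a b" if "a \<in> carrier E" "b \<in> carrier E" for a b
    using that refl[OF that] eff_hom_le[OF hom] by (auto simp: eff_le_prod_iff[OF cl cl])
  show "eff_hom E (F j) (\<lambda>a. ?f a j)" if "j \<in> I" for j
    using hom[OF that] that by simp
  show "(\<lambda>a. ?f a j) ` carrier E = carrier (F j)" if "j \<in> I" for j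
    using surj[OF that] that by simp
qed

section \<open>Lexicographic products\<close>

lemma carrier_lexico_prod [simp]: "carrier (lexico_prod H G) = carrier H \<times> carrier G"
  by (simp add: lexico_prod_def)

lemma mult_lexico_prod [simp]:
  "(a, b) \<otimes>\<^bsub>lexico_prod H G\<^esub> (c, d) = (a \<otimes>\<^bsub>H\<^esub> c, b \<otimes>\<^bsub>G\<^esub> d)"
  by (simp add: lexico_prod_def)

lemma one_lexico_prod [simp]: "\<one>\<^bsub>lexico_prod H G\<^esub> = (\<one>\<^bsub>H\<^esub>, \<one>\<^bsub>G\<^esub>)"
  by (simp add: lexico_prod_def)

lemma pole_lexico_prod [simp]:
  "(a, b) \<preceq>\<^bsub>lexico_prod H G\<^esub> (c, d) \<longleftrightarrow> a \<preceq>\<^bsub>H\<^esub> c \<and> a \<noteq> c \<or> a = c \<and> b \<preceq>\<^bsub>G\<^esub> d"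
  by (simp add: lexico_prod_def)

locale abelian_po_group_pair = H: abelian_po_group H + G: abelian_po_group G
  for H :: "('h, 'm) po_monoid_scheme" and G :: "('g, 'n) po_monoid_scheme"
begin

lemma abelian_po_group_lexico_prod: "abelian_po_group (lexico_prod H G)"
proof (rule abelian_po_groupI)
  show "comm_group (lexico_prod H G)"
  proof (rule comm_groupI)
    show "\<exists>y\<in>carrier (lexico_prod H G). y \<otimes>\<^bsub>lexico_prod H G\<^esub> x = \<one>\<^bsub>lexico_prod H G\<^esub>"
      if "x \<in> carrier (lexico_prod H G)" for x
      using that by (intro bexI[of _ "(inv\<^bsub>H\<^esub> fst x, inv\<^bsub>G\<^esub> snd x)"]) auto
  qed (auto simp: H.m_ac G.m_ac)
  show "a \<preceq>\<^bsub>lexico_prod H G\<^esub> c"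
    if "a \<in> carrier (lexico_prod H G)" "b \<in> carrier (lexico_prod H G)"
      "c \<in> carrier (lexico_prod H G)" "a \<preceq>\<^bsub>lexico_prod H G\<^esub> b" "b \<preceq>\<^bsub>lexico_prod H G\<^esub> c" for a b c
    using that by (cases a; cases b; cases c)
      (auto dest: H.pole_antisym intro: H.pole_trans G.pole_trans)
qed (auto dest: H.pole_antisym G.pole_antisym)

text \<open>After interpolating c in H, interpolation in G is called for only if all four bounds
  have first coordinate c. If exactly one lower bound, or two lower and exactly one upper bound, lie
  at c, that single element serves. In the remaining cases directedness of G supplies a common upper
  bound of r1, r2 or, through inverses, a common lower bound of s1, s2.\<close>

lemma interpolation_lexico_prod:
  assumes intH: "interpolation H" and intG: "interpolation G" and dir: "directed G"
  shows "interpolation (lexico_prod H G)"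
  unfolding interpolation_def
proof (intro ballI impI, elim conjE)
  let ?L = "lexico_prod H G"
  fix x1 x2 y1 y2
  assume cl: "x1 \<in> carrier ?L" "x2 \<in> carrier ?L" "y1 \<in> carrier ?L" "y2 \<in> carrier ?L"
    and le: "x1 \<preceq>\<^bsub>?L\<^esub> y1" "x1 \<preceq>\<^bsub>?L\<^esub> y2" "x2 \<preceq>\<^bsub>?L\<^esub> y1" "x2 \<preceq>\<^bsub>?L\<^esub> y2"
  obtain a1 a2 b1 b2 r1 r2 s1 s2 where eq: "x1 = (a1, r1)" "x2 = (a2, r2)" "y1 = (b1, s1)" "y2 = (b2, s2)"
    by (metis surj_pair)
  have clH: "a1 \<in> carrier H" "a2 \<in> carrier H" "b1 \<in> carrier H" "b2 \<in> carrier H"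
    and clG: "r1 \<in> carrier G" "r2 \<in> carrier G" "s1 \<in> carrier G" "s2 \<in> carrier G"
    using cl by (auto simp: eq)
  have "a1 \<preceq>\<^bsub>H\<^esub> b1" "a1 \<preceq>\<^bsub>H\<^esub> b2" "a2 \<preceq>\<^bsub>H\<^esub> b1" "a2 \<preceq>\<^bsub>H\<^esub> b2"
    using le clH by (auto simp: eq)
  then obtain c where c: "c \<in> carrier H" "a1 \<preceq>\<^bsub>H\<^esub> c" "a2 \<preceq>\<^bsub>H\<^esub> c" "c \<preceq>\<^bsub>H\<^esub> b1" "c \<preceq>\<^bsub>H\<^esub> b2"
    using intH[unfolded interpolation_def, rule_format, of a1 a2 b1 b2] clH by auto
  have lower: "\<exists>t\<in>carrier G. t \<preceq>\<^bsub>G\<^esub> s1 \<and> t \<preceq>\<^bsub>G\<^esub> s2"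
  proof -
    obtain k where k: "k \<in> carrier G" "inv\<^bsub>G\<^esub> s1 \<preceq>\<^bsub>G\<^esub> k" "inv\<^bsub>G\<^esub> s2 \<preceq>\<^bsub>G\<^esub> k"
      using dir clG unfolding directed_def by (meson G.inv_closed)
    then have "inv\<^bsub>G\<^esub> k \<preceq>\<^bsub>G\<^esub> s1" "inv\<^bsub>G\<^esub> k \<preceq>\<^bsub>G\<^esub> s2"
      using clG by (simp_all add: G.inv_le_iff G.m_comm)
    with k show ?thesis by blast
  qed
  \<comment> \<open>the second coordinate is constrained only by those bounds whose first coordinate is \<open>c\<close>\<close>
  have "\<exists>t\<in>carrier G. (a1 = c \<longrightarrow> r1 \<preceq>\<^bsub>G\<^esub> t) \<and> (a2 = c \<longrightarrow> r2 \<preceq>\<^bsub>G\<^esub> t) \<and>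
      (b1 = c \<longrightarrow> t \<preceq>\<^bsub>G\<^esub> s1) \<and> (b2 = c \<longrightarrow> t \<preceq>\<^bsub>G\<^esub> s2)"
  proof (cases "a1 = c"; cases "a2 = c")
    assume a: "a1 = c" "a2 = c"
    obtain k where k: "k \<in> carrier G" "r1 \<preceq>\<^bsub>G\<^esub> k" "r2 \<preceq>\<^bsub>G\<^esub> k"
      using dir clG unfolding directed_def by blast
    show ?thesis
    proof (cases "b1 = c"; cases "b2 = c")
      assume b: "b1 = c" "b2 = c"
      then have "r1 \<preceq>\<^bsub>G\<^esub> s1" "r1 \<preceq>\<^bsub>G\<^esub> s2" "r2 \<preceq>\<^bsub>G\<^esub> s1" "r2 \<preceq>\<^bsub>G\<^esub> s2"
        using le a by (auto simp: eq)
      then show ?thesis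
        using intG[unfolded interpolation_def, rule_format, of r1 r2 s1 s2] clG by blast
    next
      assume b: "b1 = c" "b2 \<noteq> c"
      then have "r1 \<preceq>\<^bsub>G\<^esub> s1" "r2 \<preceq>\<^bsub>G\<^esub> s1"
        using le a by (auto simp: eq)
      with b show ?thesis using clG G.pole_refl[of s1] by blast
    next
      assume b: "b1 \<noteq> c" "b2 = c"
      then have "r1 \<preceq>\<^bsub>G\<^esub> s2" "r2 \<preceq>\<^bsub>G\<^esub> s2"
        using le a by (auto simp: eq)
      with b show ?thesis using clG G.pole_refl[of s2] by blast
    next
      assume "b1 \<noteq> c" "b2 \<noteq> c"
      with k show ?thesis by blast
    qed
  next
    assume a: "a1 = c" "a2 \<noteq> c"
    then have "b1 = c \<Longrightarrow> r1 \<preceq>\<^bsub>G\<^esub> s1" "b2 = c \<Longrightarrow> r1 \<preceq>\<^bsub>G\<^esub> s2"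
      using le by (auto simp: eq)
    with a show ?thesis using clG G.pole_refl[of r1] by blast
  next
    assume a: "a1 \<noteq> c" "a2 = c"
    then have "b1 = c \<Longrightarrow> r2 \<preceq>\<^bsub>G\<^esub> s1" "b2 = c \<Longrightarrow> r2 \<preceq>\<^bsub>G\<^esub> s2"
      using le by (auto simp: eq)
    with a show ?thesis using clG G.pole_refl[of r2] by blast
  next
    assume "a1 \<noteq> c" "a2 \<noteq> c"
    with lower show ?thesis by blast
  qed
  then obtain t where t: "t \<in> carrier G" "a1 = c \<longrightarrow> r1 \<preceq>\<^bsub>G\<^esub> t" "a2 = c \<longrightarrow> r2 \<preceq>\<^bsub>G\<^esub> t"
      "b1 = c \<longrightarrow> t \<preceq>\<^bsub>G\<^esub> s1" "b2 = c \<longrightarrow> t \<preceq>\<^bsub>G\<^esub> s2"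
    by blast
  have "(c, t) \<in> carrier ?L" "x1 \<preceq>\<^bsub>?L\<^esub> (c, t)" "x2 \<preceq>\<^bsub>?L\<^esub> (c, t)" "(c, t) \<preceq>\<^bsub>?L\<^esub> y1" "(c, t) \<preceq>\<^bsub>?L\<^esub> y2"
    using c t by (auto simp: eq)
  then show "\<exists>z\<in>carrier ?L. x1 \<preceq>\<^bsub>?L\<^esub> z \<and> x2 \<preceq>\<^bsub>?L\<^esub> z \<and> z \<preceq>\<^bsub>?L\<^esub> y1 \<and> z \<preceq>\<^bsub>?L\<^esub> y2"
    by blast
qed

text \<open>With G trivial the second coordinate carries no information and the product is a copy of
  H.\<close>

lemma po_prime_lexico_prod_trivial:
  assumes prime: "po_prime H" and G: "carrier G = {\<one>\<^bsub>G\<^esub>}"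
  shows "po_prime (lexico_prod H G)"
  unfolding po_prime_def
proof (intro allI impI)
  fix x y assume orth: "orthogonal (lexico_prod H G) x y"
  then obtain a c where xy: "x = (a, \<one>\<^bsub>G\<^esub>)" "y = (c, \<one>\<^bsub>G\<^esub>)" and cl: "a \<in> carrier H" "c \<in> carrier H"
    using G by (auto simp: orthogonal_def pos_cone_def)
  have "\<one>\<^bsub>H\<^esub> \<preceq>\<^bsub>H\<^esub> a" "\<one>\<^bsub>H\<^esub> \<preceq>\<^bsub>H\<^esub> c"
    using orth cl by (auto simp: xy orthogonal_def pos_cone_def)
  moreover have "z \<preceq>\<^bsub>H\<^esub> \<one>\<^bsub>H\<^esub>" if z: "z \<in> carrier H" "z \<preceq>\<^bsub>H\<^esub> a" "z \<preceq>\<^bsub>H\<^esub> c" for z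
  proof -
    have "(z, \<one>\<^bsub>G\<^esub>) \<preceq>\<^bsub>lexico_prod H G\<^esub> x" "(z, \<one>\<^bsub>G\<^esub>) \<preceq>\<^bsub>lexico_prod H G\<^esub> y"
      using z by (auto simp: xy)
    then have "(z, \<one>\<^bsub>G\<^esub>) \<preceq>\<^bsub>lexico_prod H G\<^esub> \<one>\<^bsub>lexico_prod H G\<^esub>"
      using orth z(1) unfolding orthogonal_def by force
    then show ?thesis using z by auto
  qed
  ultimately have "orthogonal H a c"
    using cl by (simp add: orthogonal_def pos_cone_def)
  then show "x = \<one>\<^bsub>lexico_prod H G\<^esub> \<or> y = \<one>\<^bsub>lexico_prod H G\<^esub>"
    using prime by (auto simp: po_prime_def xy)
qed

text \<open>Only elements of the form (0, g) can take part in a nontrivial orthogonal pair, and for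
  two of them orthogonality is decided in G, whose primeness then applies.\<close>

lemma po_prime_lexico_prod_nontrivial:
  assumes prime: "po_prime G" and t: "t \<in> carrier G" "t \<noteq> \<one>\<^bsub>G\<^esub>"
  shows "po_prime (lexico_prod H G)"
  unfolding po_prime_def
proof (intro allI impI)
  fix x y assume orth: "orthogonal (lexico_prod H G) x y"
  then obtain a b c d where xy: "x = (a, b)" "y = (c, d)"
      and cl: "a \<in> carrier H" "c \<in> carrier H" "b \<in> carrier G" "d \<in> carrier G"
    by (auto simp: orthogonal_def pos_cone_def)
  have pos: "\<one>\<^bsub>H\<^esub> \<preceq>\<^bsub>H\<^esub> a \<and> \<one>\<^bsub>H\<^esub> \<noteq> a \<or> \<one>\<^bsub>H\<^esub> = a \<and> \<one>\<^bsub>G\<^esub> \<preceq>\<^bsub>G\<^esub> b"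
      "\<one>\<^bsub>H\<^esub> \<preceq>\<^bsub>H\<^esub> c \<and> \<one>\<^bsub>H\<^esub> \<noteq> c \<or> \<one>\<^bsub>H\<^esub> = c \<and> \<one>\<^bsub>G\<^esub> \<preceq>\<^bsub>G\<^esub> d"
    using orth by (auto simp: xy orthogonal_def pos_cone_def)
  have low: "(h, g) \<preceq>\<^bsub>lexico_prod H G\<^esub> \<one>\<^bsub>lexico_prod H G\<^esub>"
    if "h \<in> carrier H" "g \<in> carrier G" "(h, g) \<preceq>\<^bsub>lexico_prod H G\<^esub> x" "(h, g) \<preceq>\<^bsub>lexico_prod H G\<^esub> y" for h g
    using orth that unfolding orthogonal_def by (metis SigmaI carrier_lexico_prod)
  show "x = \<one>\<^bsub>lexico_prod H G\<^esub> \<or> y = \<one>\<^bsub>lexico_prod H G\<^esub>"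
  proof (cases "a = \<one>\<^bsub>H\<^esub>"; cases "c = \<one>\<^bsub>H\<^esub>")
    assume ac: "a \<noteq> \<one>\<^bsub>H\<^esub>" "c \<noteq> \<one>\<^bsub>H\<^esub>"
    \<comment> \<open>then \<open>{\<one>} \<times> G\<close> consists of common lower bounds of \<open>x\<close> and \<open>y\<close>\<close>
    have "g \<preceq>\<^bsub>G\<^esub> \<one>\<^bsub>G\<^esub>" if "g \<in> carrier G" for g
      using low[of "\<one>\<^bsub>H\<^esub>" g] ac pos that by (auto simp: xy)
    from this[of t] this[of "inv\<^bsub>G\<^esub> t"] have "t = \<one>\<^bsub>G\<^esub>"
      using t by (intro G.pole_antisym) simp_all
    with t show ?thesis by simp
  next
    \<comment> \<open>Here x is itself a lower bound of y, since its first coordinate is strictly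
      smaller. So x <= 0 by orthogonality, while x is positive.\<close>
    assume ac: "a = \<one>\<^bsub>H\<^esub>" "c \<noteq> \<one>\<^bsub>H\<^esub>"
    then have "x \<preceq>\<^bsub>lexico_prod H G\<^esub> \<one>\<^bsub>lexico_prod H G\<^esub>"
      using low[of a b] pos cl by (auto simp: xy)
    with ac pos cl show ?thesis
      by (auto simp: xy dest: G.pole_antisym)
  next
    assume ac: "a \<noteq> \<one>\<^bsub>H\<^esub>" "c = \<one>\<^bsub>H\<^esub>"
    then have "y \<preceq>\<^bsub>lexico_prod H G\<^esub> \<one>\<^bsub>lexico_prod H G\<^esub>"
      using low[of c d] pos cl by (auto simp: xy)
    with ac pos cl show ?thesis
      by (auto simp: xy dest: G.pole_antisym)
  next
    assume ac: "a = \<one>\<^bsub>H\<^esub>" "c = \<one>\<^bsub>H\<^esub>"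
    have "g \<preceq>\<^bsub>G\<^esub> \<one>\<^bsub>G\<^esub>" if "g \<in> carrier G" "g \<preceq>\<^bsub>G\<^esub> b" "g \<preceq>\<^bsub>G\<^esub> d" for g
      using low[of "\<one>\<^bsub>H\<^esub>" g] ac that by (auto simp: xy)
    then have "orthogonal G b d"
      using pos ac cl by (auto simp: orthogonal_def pos_cone_def)
    then show ?thesis
      using prime ac by (auto simp: po_prime_def xy)
  qed
qed

text \<open>The last conjunct makes the two kinds exclusive, so that testing
  \<open>P = carrier G\<close> tells them apart. It also makes \<open>po_quot G P\<close>
  nontrivial, as primeness of H \<times> G/P requires when H has orthogonal elements.\<close>

definition prime_pair :: "'h set \<Rightarrow> 'g set \<Rightarrow> bool" where
  "prime_pair Q P \<longleftrightarrow> o_ideal H Q \<and> o_ideal G P \<and>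
    (po_prime (po_quot H Q) \<and> P = carrier G \<or>
     Q = {\<one>\<^bsub>H\<^esub>} \<and> po_prime (po_quot G P) \<and> P \<noteq> carrier G)"

definition lexico_quot :: "'h set \<Rightarrow> 'g set \<Rightarrow> ('h set \<times> 'g set) po_monoid" where
  "lexico_quot Q P = lexico_prod (po_quot H Q) (po_quot G P)"

definition lexico_proj :: "'h set \<Rightarrow> 'g set \<Rightarrow> 'h \<times> 'g \<Rightarrow> 'h set \<times> 'g set" where
  "lexico_proj Q P x = (Q #>\<^bsub>H\<^esub> fst x, P #>\<^bsub>G\<^esub> snd x)"

lemma prime_pairD:
  assumes "prime_pair Q P"
  shows "o_ideal H Q" "o_ideal G P" "abelian_po_group_pair (po_quot H Q) (po_quot G P)"
  using assms H.abelian_po_group_po_quot G.abelian_po_group_po_quot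
  by (auto simp: prime_pair_def intro: abelian_po_group_pair.intro)

lemma abelian_po_group_lexico_quot: "prime_pair Q P \<Longrightarrow> abelian_po_group (lexico_quot Q P)"
  unfolding lexico_quot_def
  using abelian_po_group_pair.abelian_po_group_lexico_prod prime_pairD(3) by blast

lemma po_prime_lexico_quot:
  assumes pair: "prime_pair Q P"
  shows "po_prime (lexico_quot Q P)"
proof -
  interpret Q: abelian_po_group_pair "po_quot H Q" "po_quot G P"
    by (rule prime_pairD(3)[OF pair])
  note P = prime_pairD(2)[OF pair]
  show ?thesis
  proof (cases "P = carrier G")
    case True
    have "P #>\<^bsub>G\<^esub> a = P" if "a \<in> carrier G" for a
      using G.rcos_eq_ideal_iff[OF P that] that True by simp
    then have "carrier (po_quot G P) = {\<one>\<^bsub>po_quot G P\<^esub>}"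
      by (auto simp: G.carrier_po_quot)
    then show ?thesis
      using Q.po_prime_lexico_prod_trivial pair True by (simp add: prime_pair_def lexico_quot_def)
  next
    case False
    then obtain t where t: "t \<in> carrier G" "t \<notin> P"
      using G.o_ideal_carrierD[OF P] by blast
    then have "P #>\<^bsub>G\<^esub> t \<noteq> \<one>\<^bsub>po_quot G P\<^esub>" "P #>\<^bsub>G\<^esub> t \<in> carrier (po_quot G P)"
      using G.rcos_eq_ideal_iff[OF P t(1)] by (auto simp: G.carrier_po_quot)
    then show ?thesis
      using Q.po_prime_lexico_prod_nontrivial pair False by (simp add: prime_pair_def lexico_quot_def)
  qed
qed

lemma lexico_proj_hom:
  assumes pair: "prime_pair Q P"
  shows "lexico_proj Q P \<in> hom (lexico_prod H G) (lexico_quot Q P)"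
  using H.mult_po_quot[OF prime_pairD(1)[OF pair]] G.mult_po_quot[OF prime_pairD(2)[OF pair]]
  by (auto simp: hom_def lexico_proj_def lexico_quot_def H.carrier_po_quot G.carrier_po_quot)

text \<open>A strict inequality in H may become an equality modulo \<open>Q\<close>; this does no
  harm if G has a single coset. With \<open>Q\<close> trivial, strictness survives, and second
  coordinates are compared only where they were compared before.\<close>

lemma lexico_proj_mono:
  assumes pair: "prime_pair Q P" and x: "x \<in> carrier (lexico_prod H G)" and y: "y \<in> carrier (lexico_prod H G)"
    and le: "x \<preceq>\<^bsub>lexico_prod H G\<^esub> y"
  shows "lexico_proj Q P x \<preceq>\<^bsub>lexico_quot Q P\<^esub> lexico_proj Q P y"
proof -
  note Q = prime_pairD(1)[OF pair] and P = prime_pairD(2)[OF pair]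
  interpret Q: abelian_po_group_pair "po_quot H Q" "po_quot G P"
    by (rule prime_pairD(3)[OF pair])
  obtain a b c d where xy: "x = (a, b)" "y = (c, d)"
      and cl: "a \<in> carrier H" "c \<in> carrier H" "b \<in> carrier G" "d \<in> carrier G"
    using x y by auto
  show ?thesis
  proof (cases "P = carrier G")
    case True
    then have "P #>\<^bsub>G\<^esub> b = P" "P #>\<^bsub>G\<^esub> d = P"
      using G.rcos_eq_ideal_iff[OF P] cl by auto
    moreover have "a \<preceq>\<^bsub>H\<^esub> c"
      using le cl by (auto simp: xy)
    ultimately show ?thesis
      using H.po_quot_mono[OF Q cl(1,2)] Q.G.one_closed Q.G.pole_refl[of P]
      by (auto simp: xy lexico_proj_def lexico_quot_def)
  next
    case False
    then have "Q = {\<one>\<^bsub>H\<^esub>}"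
      using pair by (simp add: prime_pair_def)
    then show ?thesis
      using le cl G.po_quot_mono[OF P cl(3,4)]
      by (auto simp: xy lexico_proj_def lexico_quot_def H.rcos_singleton H.po_quot_singleton)
  qed
qed

text \<open>A preimage has to lie in the interval of the original product. If G is collapsed, its
  second coordinate is taken to be zero and the first is lifted by interpolation; if H is kept, the
  first coordinate is given and only the second has to be adjusted.\<close>

lemma lexico_proj_Gamma_surj:
  assumes pair: "prime_pair Q P" and int: "interpolation H" and u: "u \<in> pos_cone H"
  shows "carrier (Gamma (lexico_quot Q P) (Q #>\<^bsub>H\<^esub> u, \<one>\<^bsub>po_quot G P\<^esub>))
    \<subseteq> lexico_proj Q P ` carrier (Gamma (lexico_prod H G) (u, \<one>\<^bsub>G\<^esub>))"
proof
  note Q = prime_pairD(1)[OF pair] and P = prime_pairD(2)[OF pair]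
  interpret Q: abelian_po_group_pair "po_quot H Q" "po_quot G P"
    by (rule prime_pairD(3)[OF pair])
  interpret L: abelian_po_group "lexico_prod H G"
    by (rule abelian_po_group_lexico_prod)
  interpret LQ: abelian_po_group "lexico_quot Q P"
    by (rule abelian_po_group_lexico_quot[OF pair])
  have uc: "u \<in> carrier H" "\<one>\<^bsub>H\<^esub> \<preceq>\<^bsub>H\<^esub> u"
    using u by (auto simp: pos_cone_def)
  fix X assume "X \<in> carrier (Gamma (lexico_quot Q P) (Q #>\<^bsub>H\<^esub> u, \<one>\<^bsub>po_quot G P\<^esub>))"
  then obtain A B where X: "X = (A, B)" "A \<in> carrier (po_quot H Q)" "B \<in> carrier (po_quot G P)"
    and lo: "Q \<preceq>\<^bsub>po_quot H Q\<^esub> A \<and> Q \<noteq> A \<or> Q = A \<and> P \<preceq>\<^bsub>po_quot G P\<^esub> B"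
    and up: "A \<preceq>\<^bsub>po_quot H Q\<^esub> Q #>\<^bsub>H\<^esub> u \<and> A \<noteq> Q #>\<^bsub>H\<^esub> u \<or> A = Q #>\<^bsub>H\<^esub> u \<and> B \<preceq>\<^bsub>po_quot G P\<^esub> P"
    by (auto simp: LQ.carrier_Gamma) (auto simp: lexico_quot_def)
  have "\<exists>x. x \<in> carrier (lexico_prod H G) \<and> \<one>\<^bsub>lexico_prod H G\<^esub> \<preceq>\<^bsub>lexico_prod H G\<^esub> x \<and>
      x \<preceq>\<^bsub>lexico_prod H G\<^esub> (u, \<one>\<^bsub>G\<^esub>) \<and> X = lexico_proj Q P x"
  proof (cases "P = carrier G")
    case True
    then have B: "B = P #>\<^bsub>G\<^esub> \<one>\<^bsub>G\<^esub>"
      using X G.rcos_eq_ideal_iff[OF P] by (auto simp: G.carrier_po_quot)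
    have le: "Q \<preceq>\<^bsub>po_quot H Q\<^esub> A" "A \<preceq>\<^bsub>po_quot H Q\<^esub> Q #>\<^bsub>H\<^esub> u"
      using lo up Q.H.pole_refl[OF X(2)] by metis+
    then have "A \<in> pos_cone (po_quot H Q)"
      using X by (simp add: pos_cone_def)
    with le(2) obtain a where a: "a \<in> carrier H" "\<one>\<^bsub>H\<^esub> \<preceq>\<^bsub>H\<^esub> a" "a \<preceq>\<^bsub>H\<^esub> u" "A = Q #>\<^bsub>H\<^esub> a"
      using H.po_quot_interval_representative[OF int Q u] by metis
    then show ?thesis
      using B X uc by (intro exI[of _ "(a, \<one>\<^bsub>G\<^esub>)"]) (auto simp: lexico_proj_def)
  next
    case False
    then have Q1: "Q = {\<one>\<^bsub>H\<^esub>}"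
      using pair by (simp add: prime_pair_def)
    obtain a where a: "a \<in> carrier H" "A = {a}"
      using X by (auto simp: H.carrier_po_quot Q1 H.rcos_singleton)
    obtain b where b: "b \<in> carrier G" "B = P #>\<^bsub>G\<^esub> b"
      using X by (auto simp: G.carrier_po_quot)
    have lo': "\<one>\<^bsub>H\<^esub> \<preceq>\<^bsub>H\<^esub> a \<and> a \<noteq> \<one>\<^bsub>H\<^esub> \<or> a = \<one>\<^bsub>H\<^esub> \<and> P \<preceq>\<^bsub>po_quot G P\<^esub> B"
      using lo a by (auto simp: Q1 H.po_quot_singleton)
    have up': "a \<preceq>\<^bsub>H\<^esub> u \<and> a \<noteq> u \<or> a = u \<and> B \<preceq>\<^bsub>po_quot G P\<^esub> P"
      using up a uc by (auto simp: Q1 H.po_quot_singleton H.rcos_singleton)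
    have P_coset: "P #>\<^bsub>G\<^esub> \<one>\<^bsub>G\<^esub> = P"
      using G.rcos_eq_ideal_iff[OF P, of "\<one>\<^bsub>G\<^esub>"] G.o_ideal_one[OF P] by simp
    \<comment> \<open>The second coordinate is bounded below only at a = 0 and above only at a = u.
      Both happen together only if u = 0, and then \<open>B\<close> is the zero coset. At a = u
      alone, b <= p with p in \<open>P\<close> gives the nonpositive representative b - p.\<close>
    have "\<exists>g\<in>carrier G. B = P #>\<^bsub>G\<^esub> g \<and> (a = \<one>\<^bsub>H\<^esub> \<longrightarrow> \<one>\<^bsub>G\<^esub> \<preceq>\<^bsub>G\<^esub> g) \<and> (a = u \<longrightarrow> g \<preceq>\<^bsub>G\<^esub> \<one>\<^bsub>G\<^esub>)"
    proof (cases "a = \<one>\<^bsub>H\<^esub>"; cases "a = u")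
      assume "a = \<one>\<^bsub>H\<^esub>" "a = u"
      then have "B = P"
        using lo' up' X(3) Q.G.pole_antisym[of B P] Q.G.one_closed by simp
      then show ?thesis
        using P_coset by (intro bexI[of _ "\<one>\<^bsub>G\<^esub>"]) auto
    next
      assume "a = \<one>\<^bsub>H\<^esub>" "a \<noteq> u"
      moreover from this have "B \<in> pos_cone (po_quot G P)"
        using lo' X by (simp add: pos_cone_def)
      ultimately show ?thesis
        using G.po_quot_pos_representative[OF P] by metis
    next
      assume a': "a \<noteq> \<one>\<^bsub>H\<^esub>" "a = u"
      then have "P #>\<^bsub>G\<^esub> b \<preceq>\<^bsub>po_quot G P\<^esub> P #>\<^bsub>G\<^esub> \<one>\<^bsub>G\<^esub>"
        using up' b by (simp add: P_coset)
      then obtain p where p: "p \<in> P" "b \<preceq>\<^bsub>G\<^esub> p"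
        using b G.o_ideal_carrierD[OF P] by (auto simp: G.pole_po_quot[OF P])
      have pc: "p \<in> carrier G"
        using G.o_ideal_carrierD[OF P p(1)] .
      have "b \<otimes>\<^bsub>G\<^esub> inv\<^bsub>G\<^esub> p \<preceq>\<^bsub>G\<^esub> \<one>\<^bsub>G\<^esub>"
        using p b pc by (simp add: G.mult_inv_le_iff)
      moreover have "B = P #>\<^bsub>G\<^esub> (b \<otimes>\<^bsub>G\<^esub> inv\<^bsub>G\<^esub> p)"
        using b p pc G.o_ideal_inv[OF P p(1)] G.rcos_eq_iff[OF P, of "b \<otimes>\<^bsub>G\<^esub> inv\<^bsub>G\<^esub> p" b] by auto
      ultimately show ?thesis
        using a' b pc by (intro bexI[of _ "b \<otimes>\<^bsub>G\<^esub> inv\<^bsub>G\<^esub> p"]) auto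
    qed (use b in auto)
    then obtain g where g: "g \<in> carrier G" "B = P #>\<^bsub>G\<^esub> g"
        "a = \<one>\<^bsub>H\<^esub> \<longrightarrow> \<one>\<^bsub>G\<^esub> \<preceq>\<^bsub>G\<^esub> g" "a = u \<longrightarrow> g \<preceq>\<^bsub>G\<^esub> \<one>\<^bsub>G\<^esub>"
      by blast
    then show ?thesis
      using lo' up' X a
      by (intro exI[of _ "(a, g)"]) (auto simp: lexico_proj_def Q1 H.rcos_singleton)
  qed
  then show "X \<in> lexico_proj Q P ` carrier (Gamma (lexico_prod H G) (u, \<one>\<^bsub>G\<^esub>))"
    unfolding L.carrier_Gamma by blast
qed

lemma lexico_proj_separating:
  assumes dir: "directed G" and x: "x \<in> carrier (lexico_prod H G)" and y: "y \<in> carrier (lexico_prod H G)"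
    and nle: "\<not> x \<preceq>\<^bsub>lexico_prod H G\<^esub> y"
  obtains Q P where "prime_pair Q P" "\<not> lexico_proj Q P x \<preceq>\<^bsub>lexico_quot Q P\<^esub> lexico_proj Q P y"
proof -
  obtain a b c d where xy: "x = (a, b)" "y = (c, d)"
      and cl: "a \<in> carrier H" "c \<in> carrier H" "b \<in> carrier G" "d \<in> carrier G"
    using x y by auto
  show thesis
  proof (cases "a \<preceq>\<^bsub>H\<^esub> c")
    case False
    then obtain Q where Q: "o_ideal H Q" "po_prime (po_quot H Q)"
        "\<not> Q #>\<^bsub>H\<^esub> a \<preceq>\<^bsub>po_quot H Q\<^esub> Q #>\<^bsub>H\<^esub> c"
      using H.prime_o_ideal_separating cl by metis
    interpret Q: abelian_po_group "po_quot H Q"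
      by (rule H.abelian_po_group_po_quot[OF Q(1)])
    have "prime_pair Q (carrier G)"
      using Q G.o_ideal_carrier[OF dir] by (simp add: prime_pair_def)
    \<comment> \<open>Distinctness is needed besides non-comparability: equal first coordinates
      would leave the decision to the second ones, which coincide here.\<close>
    moreover have "Q #>\<^bsub>H\<^esub> a \<noteq> Q #>\<^bsub>H\<^esub> c"
      using Q(3) cl Q.pole_refl by (force simp: H.carrier_po_quot)
    ultimately show thesis
      using that Q(3) by (simp add: xy lexico_proj_def lexico_quot_def)
  next
    case True
    then have "a = c" "\<not> b \<preceq>\<^bsub>G\<^esub> d"
      using nle by (auto simp: xy)
    then obtain P where P: "o_ideal G P" "po_prime (po_quot G P)"
        "\<not> P #>\<^bsub>G\<^esub> b \<preceq>\<^bsub>po_quot G P\<^esub> P #>\<^bsub>G\<^esub> d"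
      using G.prime_o_ideal_separating cl by metis
    interpret P: abelian_po_group "po_quot G P"
      by (rule G.abelian_po_group_po_quot[OF P(1)])
    \<comment> \<open>With a single coset nothing could be separated, so separation itself yields
      nontriviality.\<close>
    have "P \<noteq> carrier G"
    proof
      assume "P = carrier G"
      then have "P #>\<^bsub>G\<^esub> b = P" "P #>\<^bsub>G\<^esub> d = P"
        using G.rcos_eq_ideal_iff[OF P(1)] cl by auto
      with P(3) P.pole_refl[OF P.one_closed] show False by simp
    qed
    then have "prime_pair {\<one>\<^bsub>H\<^esub>} P"
      using P H.o_ideal_singleton by (simp add: prime_pair_def)
    then show thesis
      using that P(3) \<open>a = c\<close> by (simp add: xy lexico_proj_def lexico_quot_def)
  qed
qed

end

section \<open>The subdirect representation\<close>

theorem theorem6p12: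
  fixes H :: "'h po_monoid" and G :: "'g po_monoid" and u :: 'h
  assumes "abelian_po_group H" and "strong_unit H u" and "group_RDP H"
    and "abelian_po_group G" and "directed G" and "group_RDP G"
  shows "\<exists>(I :: ('h \<times> 'g) set set)
           (Hi :: ('h \<times> 'g) set \<Rightarrow> 'h set po_monoid)
           (Gi :: ('h \<times> 'g) set \<Rightarrow> 'g set po_monoid)
           (ui :: ('h \<times> 'g) set \<Rightarrow> 'h set).
    (\<forall>i\<in>I. abelian_po_group (Hi i) \<and> strong_unit (Hi i) (ui i) \<and> group_RDP (Hi i) \<and>
            abelian_po_group (Gi i) \<and> directed (Gi i) \<and> group_RDP (Gi i)) \<and>
    (\<forall>i\<in>I. effect_algebra (Gamma (lexico_prod (Hi i) (Gi i)) (ui i, \<one>\<^bsub>Gi i\<^esub>)) \<and>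
            antilattice (eff_order (Gamma (lexico_prod (Hi i) (Gi i)) (ui i, \<one>\<^bsub>Gi i\<^esub>))) \<and>
            eff_RDP (Gamma (lexico_prod (Hi i) (Gi i)) (ui i, \<one>\<^bsub>Gi i\<^esub>))) \<and>
    subdirect_product (Gamma (lexico_prod H G) (u, \<one>\<^bsub>G\<^esub>)) I
      (\<lambda>i. Gamma (lexico_prod (Hi i) (Gi i)) (ui i, \<one>\<^bsub>Gi i\<^esub>))"
proof -
  interpret abelian_po_group_pair H G
    using assms by (intro abelian_po_group_pair.intro)
  interpret L: abelian_po_group "lexico_prod H G"
    by (rule abelian_po_group_lexico_prod)
  have intH: "interpolation H" and intG: "interpolation G"
    using assms H.RDP_imp_interpolation G.RDP_imp_interpolation by blast+
  have u: "u \<in> pos_cone H" "u \<in> carrier H"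
    using assms(2) by (auto simp: strong_unit_def pos_cone_def)
  have u_L: "(u, \<one>\<^bsub>G\<^esub>) \<in> carrier (lexico_prod H G)" "(u, \<one>\<^bsub>G\<^esub>) \<in> pos_cone (lexico_prod H G)"
    using u by (auto simp: pos_cone_def)
  \<comment> \<open>A pair of o-ideals is encoded as one set of pairs. Both components contain the
    unit, so neither is empty and the images under \<open>fst\<close> and \<open>snd\<close> recover
    them.\<close>
  define I where "I = {Q \<times> P | Q P. prime_pair Q P}"
  define Hi where "Hi i = po_quot H (fst ` i)" for i :: "('h \<times> 'g) set"
  define Gi where "Gi i = po_quot G (snd ` i)" for i :: "('h \<times> 'g) set"
  define ui where "ui i = fst ` i #>\<^bsub>H\<^esub> u" for i :: "('h \<times> 'g) set"
  have proj: "fst ` (Q \<times> P) = Q" "snd ` (Q \<times> P) = P" if "prime_pair Q P" for Q P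
    using H.o_ideal_one[OF prime_pairD(1)[OF that]] G.o_ideal_one[OF prime_pairD(2)[OF that]]
    by auto
  have I: "prime_pair (fst ` i) (snd ` i)" if "i \<in> I" for i
    using that proj by (auto simp: I_def)
  let ?E = "Gamma (lexico_prod H G) (u, \<one>\<^bsub>G\<^esub>)"
  let ?F = "\<lambda>i. Gamma (lexico_prod (Hi i) (Gi i)) (ui i, \<one>\<^bsub>Gi i\<^esub>)"
  let ?\<phi> = "\<lambda>i. lexico_proj (fst ` i) (snd ` i)"
  \<comment> \<open>This presents the top of each factor as the image of the top of the given
    algebra, the form that \<open>eff_hom_Gamma\<close> produces.\<close>
  have F_eq: "?F i = Gamma (lexico_quot (fst ` i) (snd ` i)) (?\<phi> i (u, \<one>\<^bsub>G\<^esub>))" if "i \<in> I" for i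
    using G.rcos_eq_ideal_iff[OF prime_pairD(2)[OF I[OF that]], of "\<one>\<^bsub>G\<^esub>"]
      G.o_ideal_one[OF prime_pairD(2)[OF I[OF that]]]
    by (simp add: Hi_def Gi_def ui_def lexico_quot_def lexico_proj_def)
  have groups: "abelian_po_group (Hi i) \<and> strong_unit (Hi i) (ui i) \<and> interpolation (Hi i) \<and>
      abelian_po_group (Gi i) \<and> directed (Gi i) \<and> interpolation (Gi i)" if "i \<in> I" for i
    unfolding Hi_def Gi_def ui_def
    using prime_pairD(1,2)[OF I[OF that]] assms intH intG
    by (intro conjI H.abelian_po_group_po_quot G.abelian_po_group_po_quot H.strong_unit_po_quot
        G.directed_po_quot H.interpolation_po_quot G.interpolation_po_quot)
  have algebras: "effect_algebra (?F i) \<and> antilattice (eff_order (?F i)) \<and> eff_RDP (?F i)"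
    if i: "i \<in> I" for i
  proof -
    interpret i: abelian_po_group_pair "Hi i" "Gi i"
      using groups[OF i] by (intro abelian_po_group_pair.intro) auto
    interpret Li: abelian_po_group "lexico_prod (Hi i) (Gi i)"
      by (rule i.abelian_po_group_lexico_prod)
    have int: "interpolation (lexico_prod (Hi i) (Gi i))"
      using groups[OF i] by (intro i.interpolation_lexico_prod) auto
    have prime: "po_prime (lexico_prod (Hi i) (Gi i))"
      using po_prime_lexico_quot[OF I[OF i]] by (simp add: lexico_quot_def Hi_def Gi_def)
    have pos: "(ui i, \<one>\<^bsub>Gi i\<^esub>) \<in> pos_cone (lexico_prod (Hi i) (Gi i))"
      using groups[OF i] by (auto simp: strong_unit_def pos_cone_def)
    then have "(ui i, \<one>\<^bsub>Gi i\<^esub>) \<in> carrier (lexico_prod (Hi i) (Gi i))"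
      by (simp add: pos_cone_def)
    with pos show ?thesis
      using Li.effect_algebra_Gamma Li.antilattice_Gamma[OF _ int prime]
        Li.eff_RDP_Gamma[OF _ Li.interpolation_imp_RDP[OF int]] by blast
  qed
  have "subdirect_product ?E I ?F"
  proof (rule subdirect_productI[where \<phi> = ?\<phi>])
    show hom: "eff_hom ?E (?F i) (?\<phi> i)" if "i \<in> I" for i
      unfolding F_eq[OF that]
      using abelian_po_group_lexico_prod abelian_po_group_lexico_quot[OF I[OF that]]
        lexico_proj_hom[OF I[OF that]] lexico_proj_mono[OF I[OF that]] u_L(1)
      by (rule eff_hom_Gamma)
    show "?\<phi> i ` carrier ?E = carrier (?F i)" if "i \<in> I" for i
    proof
      show "?\<phi> i ` carrier ?E \<subseteq> carrier (?F i)"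
        using hom[OF that] by (auto simp: eff_hom_def)
      show "carrier (?F i) \<subseteq> ?\<phi> i ` carrier ?E"
        using lexico_proj_Gamma_surj[OF I[OF that] intH u(1)]
        by (simp add: Hi_def Gi_def ui_def lexico_quot_def)
    qed
    have le_F: "eff_le (?F i) (?\<phi> i x) (?\<phi> i y)
        \<longleftrightarrow> ?\<phi> i x \<preceq>\<^bsub>lexico_quot (fst ` i) (snd ` i)\<^esub> ?\<phi> i y"
      if "i \<in> I" "x \<in> carrier ?E" "y \<in> carrier ?E" for i x y
    proof -
      interpret Li: abelian_po_group "lexico_quot (fst ` i) (snd ` i)"
        by (rule abelian_po_group_lexico_quot[OF I[OF that(1)]])
      show ?thesis
        unfolding F_eq[OF that(1)]
        using that hom[OF that(1)] hom_in_carrier[OF lexico_proj_hom[OF I[OF that(1)]] u_L(1)]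
        by (intro Li.eff_le_Gamma) (auto simp: eff_hom_def F_eq)
    qed
    have reflect: "x \<preceq>\<^bsub>lexico_prod H G\<^esub> y"
      if xy: "x \<in> carrier ?E" "y \<in> carrier ?E" "\<And>i. i \<in> I \<Longrightarrow> eff_le (?F i) (?\<phi> i x) (?\<phi> i y)" for x y
    proof (rule ccontr)
      assume nle: "\<not> x \<preceq>\<^bsub>lexico_prod H G\<^esub> y"
      have "x \<in> carrier (lexico_prod H G)" "y \<in> carrier (lexico_prod H G)"
        using xy by (auto simp: L.carrier_Gamma)
      then obtain Q P where QP: "prime_pair Q P"
          "\<not> lexico_proj Q P x \<preceq>\<^bsub>lexico_quot Q P\<^esub> lexico_proj Q P y"
        using lexico_proj_separating[OF assms(5) _ _ nle] by blast
      then have "Q \<times> P \<in> I" by (auto simp: I_def)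
      from xy(3)[OF this] le_F[OF this xy(1,2)] QP(2) show False
        by (simp only: proj[OF QP(1)] simp_thms)
    qed
    show "eff_le ?E x y"
      if "x \<in> carrier ?E" "y \<in> carrier ?E" "\<And>i. i \<in> I \<Longrightarrow> eff_le (?F i) (?\<phi> i x) (?\<phi> i y)" for x y
      using reflect[OF that] L.eff_le_Gamma[OF u_L(1) that(1,2)] by blast
    show "x = y"
      if xy: "x \<in> carrier ?E" "y \<in> carrier ?E" and eq: "\<And>i. i \<in> I \<Longrightarrow> ?\<phi> i x = ?\<phi> i y" for x y
    proof -
      have refl: "eff_le (?F i) (?\<phi> i x) (?\<phi> i x)" if "i \<in> I" for i
      proof -
        interpret Li: abelian_po_group "lexico_quot (fst ` i) (snd ` i)"
          by (rule abelian_po_group_lexico_quot[OF I[OF that]])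
        show ?thesis
          using le_F[OF that xy(1,1)] hom_in_carrier[OF lexico_proj_hom[OF I[OF that]], of x] xy(1)
          by (simp add: L.carrier_Gamma)
      qed
      \<comment> \<open>Equal images are below each other in every factor, so injectivity is order
        reflection in both directions followed by antisymmetry.\<close>
      have "x \<preceq>\<^bsub>lexico_prod H G\<^esub> y" "y \<preceq>\<^bsub>lexico_prod H G\<^esub> x"
        using refl eq by (auto intro!: reflect xy)
      then show ?thesis
        using xy L.pole_antisym by (auto simp: L.carrier_Gamma)
    qed
  qed
  moreover have "abelian_po_group (Hi i) \<and> strong_unit (Hi i) (ui i) \<and> group_RDP (Hi i) \<and>
      abelian_po_group (Gi i) \<and> directed (Gi i) \<and> group_RDP (Gi i)" if "i \<in> I" for i
    using groups[OF that] abelian_po_group.interpolation_imp_RDP[of "Hi i"]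
      abelian_po_group.interpolation_imp_RDP[of "Gi i"] by simp
  ultimately show ?thesis
    using algebras by (intro exI[of _ I] exI[of _ Hi] exI[of _ Gi] exI[of _ ui] conjI ballI) simp_all
qed

end
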